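(* Let $\kappa\in\mathbb R$, let $(M,d)$ be a $\mathrm{CAT}(\kappa)$ space and let $C\subseteq M$ be a convex domain. For every integer $n\ge1$, the barycenter map $\hat B_n:C^n\to C$ is $L/n$-Lipschitz with respect to the $\ell^1$-product distance $d_1^{(n)}$, i.e. $$d\big(\hat B_n(x_1,\dots,x_n),\hat B_n(y_1,\dots,y_n)\big)\le \frac{L}{n}\sum_{i=1}^n d(x_i,y_i)\quad\forall x_i,y_i\in C,$$ where $L=1$ if $\kappa\le0$, and $L=2/(\varepsilon^{1/4}\kappa^{1/8})$ if $\kappa>0$, with $\varepsilon>0$ such that $C$ is contained in a closed ball of radius $\frac12(D_\kappa/2-\varepsilon)$.
   Context: $D_\kappa=\infty$ if $\kappa\le0$, $D_\kappa=\pi/\sqrt\kappa$ if $\kappa>0$. A $\mathrm{CAT}(\kappa)$ space is a complete geodesic metric space whose geodesic triangles of perimeter $<2D_\kappa$ are no fatter than their comparison triangles in the model plane $M_\kappa$ of constant curvature $\kappa$ (distances between points on the triangle are at most the distances between corresponding points of the comparison triangle). A convex domain is: any closed geodesically convex subset if $\kappa\le 0$; any closed geodesically convex subset contained in a closed ball of radius $<D_\kappa/4$ if $\kappa>0$. For $x_1,\dots,x_n\in C$, the measure $\frac1n\sum_i\delta_{x_i}$ has a unique barycenter (minimizer of $b\mapsto\frac1n\sum_i d(x_i,b)^2$), which lies in $C$; it is denoted $\hat B_n(x_1,\dots,x_n)$. The distance $d_1^{(n)}$ on $M^n$ is $d_1^{(n)}((x_i),(y_i))=\sum_{i=1}^n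 d(x_i,y_i)$. *)

theory Defs
  imports "HOL-Analysis.Analysis"
begin

definition geodesic_between ::
  "'b set \<Rightarrow> ('b \<Rightarrow> 'b \<Rightarrow> real) \<Rightarrow> (real \<Rightarrow> 'b) \<Rightarrow> 'b \<Rightarrow> 'b \<Rightarrow> bool" where
  "geodesic_between S dd \<gamma> x y \<longleftrightarrow>
     \<gamma> 0 = x \<and> \<gamma> (dd x y) = y \<and> \<gamma> ` {0..dd x y} \<subseteq> S \<and>
     (\<forall>s\<in>{0..dd x y}. \<forall>t\<in>{0..dd x y}. dd (\<gamma> s) (\<gamma> t) = \<bar>s - t\<bar>)"

definition geodesic_space :: "'a::metric_space set \<Rightarrow> bool" where
  "geodesic_space M \<longleftrightarrow> (\<forall>x\<in>M. \<forall>y\<in>M. \<exists>\<gamma>. geodesic_between M dist \<gamma> x y)"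

text \<open>The diameter-type constant D_kappa (only used for kappa > 0; D_kappa = infinity otherwise).\<close>
definition Dk :: "real \<Rightarrow> real" where
  "Dk \<kappa> = pi / sqrt \<kappa>"

text \<open>Model plane M_kappa realised inside R^3:
  kappa = 0: the plane x3 = 0 with the Euclidean distance;
  kappa > 0: the unit sphere with angular distance scaled by 1/sqrt kappa;
  kappa < 0: the upper sheet of the hyperboloid (Minkowski model) scaled by 1/sqrt(-kappa).\<close>
definition model_space :: "real \<Rightarrow> (real^3) set" where
  "model_space \<kappa> =
     (if \<kappa> = 0 then {v. v$3 = 0}
      else if \<kappa> > 0 then {v. norm v = 1}
      else {v. v$3 > 0 \<and> (v$3)^2 - (v$1)^2 - (v$2)^2 = 1})"

definition model_dist :: "real \<Rightarrow> real^3 \<Rightarrow> real^3 \<Rightarrow> real" where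
  "model_dist \<kappa> u v =
     (if \<kappa> = 0 then dist u v
      else if \<kappa> > 0 then arccos (u \<bullet> v) / sqrt \<kappa>
      else arcosh (u$3 * v$3 - u$1 * v$1 - u$2 * v$2) / sqrt (- \<kappa>))"

definition CAT :: "real \<Rightarrow> 'a::metric_space set \<Rightarrow> bool" where
  "CAT \<kappa> M \<longleftrightarrow> complete M \<and> geodesic_space M \<and>
    (\<forall>(v::nat \<Rightarrow> 'a) (\<gamma>::nat \<Rightarrow> real \<Rightarrow> 'a) (vb::nat \<Rightarrow> real^3) (\<gamma>b::nat \<Rightarrow> real \<Rightarrow> real^3).
       (\<forall>i<3. v i \<in> M \<and> geodesic_between M dist (\<gamma> i) (v i) (v (Suc i mod 3))) \<and>
       (\<kappa> \<le> 0 \<or> (\<Sum>i<3. dist (v i) (v (Suc i mod 3))) < 2 * Dk \<kappa>) \<and>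
       (\<forall>i<3. vb i \<in> model_space \<kappa> \<and>
              model_dist \<kappa> (vb i) (vb (Suc i mod 3)) = dist (v i) (v (Suc i mod 3)) \<and>
              geodesic_between (model_space \<kappa>) (model_dist \<kappa>) (\<gamma>b i) (vb i) (vb (Suc i mod 3)))
       \<longrightarrow>
       (\<forall>i<3. \<forall>j<3. \<forall>s\<in>{0..dist (v i) (v (Suc i mod 3))}. \<forall>t\<in>{0..dist (v j) (v (Suc j mod 3))}.
          dist (\<gamma> i s) (\<gamma> j t) \<le> model_dist \<kappa> (\<gamma>b i s) (\<gamma>b j t)))"

definition geodesically_convex :: "'a::metric_space set \<Rightarrow> 'a set \<Rightarrow> bool" where
  "geodesically_convex M C \<longleftrightarrow>
     (\<forall>x\<in>C. \<forall>y\<in>C. \<forall>\<gamma>. geodesic_between M dist \<gamma> x y \<longrightarrow> \<gamma> ` {0..dist x y} \<subseteq> C)"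

definition convex_domain :: "real \<Rightarrow> 'a::metric_space set \<Rightarrow> 'a set \<Rightarrow> bool" where
  "convex_domain \<kappa> M C \<longleftrightarrow> C \<subseteq> M \<and> closed C \<and> geodesically_convex M C \<and>
     (\<kappa> > 0 \<longrightarrow> (\<exists>p\<in>M. \<exists>r. r < Dk \<kappa> / 4 \<and> C \<subseteq> cball p r))"

text \<open>Barycenter \<hat>B_n(x_0,...,x_{n-1}) of the empirical measure (1/n) sum delta_{x_i}:
  the (unique) minimiser over M of b \<mapsto> (1/n) sum d(x_i,b)^2.\<close>
definition barycenter :: "'a::metric_space set \<Rightarrow> nat \<Rightarrow> (nat \<Rightarrow> 'a) \<Rightarrow> 'a" where
  "barycenter M n x =
     (THE b. b \<in> M \<and> (\<forall>c\<in>M. (1 / real n) * (\<Sum>i<n. (dist (x i) b)^2)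
                              \<le> (1 / real n) * (\<Sum>i<n. (dist (x i) c)^2)))"

end

(*
  For kappa <= 0 the space satisfies the Bruhat-Tits inequality, hence the variance inequality
  F(z) >= F(b) + n d(b,z)^2 at the minimiser b of F = sum d(x_i, .)^2 and Reshetnyak's quadrilateral
  inequality.  Adding the two variance inequalities for b = B(x), b' = B(y) and bounding the result
  by the quadrilateral inequality gives n d(b,b') <= sum d(x_i,y_i).

  For kappa > 0 rescale to kappa = 1, so that C lies in a ball of centre p and radius
  R = pi/4 - eps/2.  With w(r) = r / sin r, the first variation at b reads
      sum w(d(x_i,b)) cos d(x_i,z) <= cos d(b,z) sum w(d(x_i,b)) cos d(x_i,b)   for all z.
  Taking z = p bounds the sum on the right from below by n cos R / cos d(p,b); taking z = b', adding
  the inequality with the roles of x and y exchanged, and estimating the difference by the spherical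
  quadrilateral inequality and the Lipschitz continuity of w gives the constant
  w(R) (4/3 + 2 R tan R), uniformly bounded as eps -> 0 and smaller than 2 / eps^(1/4).
*)
theory Submission
  imports Defs
begin

section \<open>Trigonometric estimates\<close>

text \<open>For positive \<kappa> the obstacle is uniformity. Two points of \<open>C\<close> can be
  almost pi / 2 apart after rescaling, so bounding each \<open>cos d(x_i,b)\<close> from below by
  \<open>cos (2 * R)\<close>, which is the sine of the rescaled \<epsilon>, would cost a factor of
  order 1 / \<epsilon>. The centre \<open>p\<close> is within \<open>R\<close> < pi / 4 of all
  points of \<open>C\<close>, and testing there bounds the whole sum although single summands may be
  tiny. The price is the factor \<open>cos d(p,b)\<close>; it is repaid by evaluating the weights at
  \<open>R + d(p,b)\<close> rather than at \<open>2 * R\<close>.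

  The weight \<open>r / sin r\<close> is minus half the derivative of the square of arccos:
  comparison in the sphere is linear in cosines, while the functional is quadratic in distances.
  Squared distances need not be differentiable along geodesics, so the first variation uses smooth
  majorants that touch them at \<open>b\<close>.

  The barycenter is a definite description over all of \<open>M\<close>, so existence and uniqueness
  belong to the proof. For positive \<kappa> a minimiser is found in \<open>C\<close>, points
  outside \<open>C\<close> are beaten by their projection or by a data point, and uniqueness is the
  Lipschitz estimate itself for equal data.\<close>

lemma cos_ge_quadratic: "1 - x\<^sup>2 / 2 \<le> cos x" if "0 \<le> x" for x :: real
proof -
  have "cos 0 + 0\<^sup>2 / 2 \<le> cos x + x\<^sup>2 / 2"
    by (rule DERIV_nonneg_imp_nondecreasing[OF that])
       (intro exI[of _ "- sin _ + _"] conjI derivative_eq_intros, auto intro: sin_x_le_x)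
  then show ?thesis by simp
qed

lemma sin_ge_cubic: "x - x ^ 3 / 6 \<le> sin x" if "0 \<le> x" for x :: real
proof -
  have "sin 0 - 0 + 0 ^ 3 / 6 \<le> sin x - x + x ^ 3 / 6"
  proof (rule DERIV_nonneg_imp_nondecreasing[OF that])
    fix t :: real assume "0 \<le> t"
    have "((\<lambda>x. sin x - x + x ^ 3 / 6) has_real_derivative (cos t - 1 + t\<^sup>2 / 2)) (at t)"
      by (auto intro!: derivative_eq_intros simp: power2_eq_square)
    then show "\<exists>y. ((\<lambda>x. sin x - x + x ^ 3 / 6) has_real_derivative y) (at t) \<and> 0 \<le> y"
      using cos_ge_quadratic[OF \<open>0 \<le> t\<close>] by (intro exI conjI) auto
  qed
  then show ?thesis by simp
qed

lemma cos_le_quartic: "cos x \<le> 1 - x\<^sup>2 / 2 + x ^ 4 / 24" if "0 \<le> x" for x :: real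
proof -
  have "1 - 0\<^sup>2 / 2 + 0 ^ 4 / 24 - cos 0 \<le> 1 - x\<^sup>2 / 2 + x ^ 4 / 24 - cos x"
  proof (rule DERIV_nonneg_imp_nondecreasing[OF that])
    fix t :: real assume "0 \<le> t"
    have "((\<lambda>x. 1 - x\<^sup>2 / 2 + x ^ 4 / 24 - cos x) has_real_derivative (- t + t ^ 3 / 6 + sin t)) (at t)"
      by (auto intro!: derivative_eq_intros simp: power2_eq_square)
    then show "\<exists>y. ((\<lambda>x. 1 - x\<^sup>2 / 2 + x ^ 4 / 24 - cos x) has_real_derivative y) (at t) \<and> 0 \<le> y"
      using sin_ge_cubic[OF \<open>0 \<le> t\<close>] by (intro exI conjI) auto
  qed
  then show ?thesis by simp
qed

text \<open>\<open>8 / 5\<close> is a rational point just beyond pi / 2 at which the quartic Taylor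
  majorant of the cosine is already negative. It makes the final numerical check on
  \<open>pi / 2 - 2 * R\<close> a matter of rational arithmetic.\<close>

lemma pi_half_less: "pi / 2 < 8 / 5"
proof (rule ccontr)
  assume "\<not> pi / 2 < 8 / 5"
  then have "0 \<le> cos (8 / 5 :: real)" by (intro cos_ge_zero) auto
  then show False using cos_le_quartic[of "8 / 5"] by (simp add: power2_eq_square eval_nat_numeral)
qed

text \<open>This is the numerator of the derivative of \<open>r / sin r\<close>; its own derivative
  is \<open>x * sin x\<close>.\<close>

lemma sin_minus_cos_nonneg: "0 \<le> sin x - x * cos x" if "0 \<le> x" "x \<le> pi" for x :: real
proof -
  have "sin 0 - 0 * cos 0 \<le> sin x - x * cos x"
  proof (rule DERIV_nonneg_imp_nondecreasing[OF that(1)])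
    fix t :: real assume "0 \<le> t" "t \<le> x"
    have "((\<lambda>x. sin x - x * cos x) has_real_derivative (t * sin t)) (at t)"
      by (auto intro!: derivative_eq_intros)
    then show "\<exists>y. ((\<lambda>x. sin x - x * cos x) has_real_derivative y) (at t) \<and> 0 \<le> y"
      using \<open>0 \<le> t\<close> \<open>t \<le> x\<close> that
      by (intro exI[of _ "t * sin t"]) (auto intro!: mult_nonneg_nonneg sin_ge_zero)
  qed
  then show ?thesis by simp
qed

lemma sin_minus_cos_le_cubic: "sin x - x * cos x \<le> x ^ 3 / 3" if "0 \<le> x" for x :: real
proof -
  have "0 ^ 3 / 3 - sin 0 + 0 * cos 0 \<le> x ^ 3 / 3 - sin x + x * cos x"
  proof (rule DERIV_nonneg_imp_nondecreasing[OF that(1)])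
    fix t :: real assume "0 \<le> t" "t \<le> x"
    have "((\<lambda>x. x ^ 3 / 3 - sin x + x * cos x) has_real_derivative (t * (t - sin t))) (at t)"
      by (auto intro!: derivative_eq_intros simp: algebra_simps power2_eq_square)
    then show "\<exists>y. ((\<lambda>x. x ^ 3 / 3 - sin x + x * cos x) has_real_derivative y) (at t) \<and> 0 \<le> y"
      using sin_x_le_x[of t] \<open>0 \<le> t\<close> by (intro exI[of _ "t * (t - sin t)"]) auto
  qed
  then show ?thesis by simp
qed

text \<open>The Mitrinovic-Adamovic inequality. The Taylor bounds for sine and cosine reduce it,
  after division by \<open>x ^ 3\<close>, to a polynomial inequality whose sides differ by
  \<open>x ^ 4 / 24 * (1 - x\<^sup>2 / 9)\<close>.\<close>

lemma cubed_cos_le_sin_cubed: "x ^ 3 * cos x \<le> sin x ^ 3" if "0 \<le> x" "x \<le> 2" for x :: real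
proof -
  have x2: "x\<^sup>2 \<le> 4" using power_mono[OF that(2,1), of 2] by simp
  have "x ^ 3 * cos x \<le> x ^ 3 * (1 - x\<^sup>2 / 2 + x ^ 4 / 24)"
    using cos_le_quartic[OF that(1)] that by (intro mult_left_mono) auto
  also have "\<dots> \<le> x ^ 3 * (1 - x\<^sup>2 / 6) ^ 3"
  proof (rule mult_left_mono)
    have "(1 - x\<^sup>2 / 6) ^ 3 - (1 - x\<^sup>2 / 2 + x ^ 4 / 24) = x ^ 4 / 24 * (1 - x\<^sup>2 / 9)"
      by (simp add: field_simps power2_eq_square eval_nat_numeral)
    moreover have "0 \<le> x ^ 4 / 24 * (1 - x\<^sup>2 / 9)" using x2 by (intro mult_nonneg_nonneg) auto
    ultimately show "1 - x\<^sup>2 / 2 + x ^ 4 / 24 \<le> (1 - x\<^sup>2 / 6) ^ 3" by linarith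
  qed (use that in auto)
  also have "\<dots> = (x - x ^ 3 / 6) ^ 3"
    by (simp add: field_simps power2_eq_square eval_nat_numeral)
  also have "\<dots> \<le> sin x ^ 3"
  proof (rule power_mono[OF sin_ge_cubic[OF that(1)]])
    have "x - x ^ 3 / 6 = x * (1 - x\<^sup>2 / 6)" by (simp add: power2_eq_square eval_nat_numeral field_simps)
    also have "0 \<le> \<dots>" using x2 that by (intro mult_nonneg_nonneg) auto
    finally show "0 \<le> x - x ^ 3 / 6" .
  qed
  finally show ?thesis .
qed

section \<open>The weight r / sin r and its derivative\<close>

text \<open>The value at \<open>0\<close> is the limit. A data point may coincide with a minimiser,
  and its weight must then still be at least 1.\<close>

definition wt :: "real \<Rightarrow> real" where
  "wt r = (if r = 0 then 1 else r / sin r)"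

definition wt_deriv :: "real \<Rightarrow> real" where
  "wt_deriv r = (sin r - r * cos r) / (sin r)\<^sup>2"

lemma wt_mult_sin: "wt r * sin r = r" if "0 \<le> r" "r < pi"
  using that sin_gt_zero[of r] by (cases "r = 0") (auto simp: wt_def)

lemma wt_ge_1: "1 \<le> wt r" if "0 \<le> r" "r < pi"
proof (cases "r = 0")
  case False
  then have "0 < sin r" using that by (intro sin_gt_zero) auto
  then show ?thesis using sin_x_le_x[OF that(1)] False by (simp add: wt_def)
qed (simp add: wt_def)

lemma wt_deriv_nonneg: "0 \<le> wt_deriv r" if "0 \<le> r" "r \<le> pi"
  using sin_minus_cos_nonneg[OF that] by (simp add: wt_deriv_def)

lemma has_real_derivative_wt:
  assumes "0 < r" "r < pi"
  shows "(wt has_real_derivative wt_deriv r) (at r)"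
proof -
  have "sin r \<noteq> 0" using sin_gt_zero[of r] assms by auto
  then have "((\<lambda>r. r / sin r) has_real_derivative wt_deriv r) (at r)"
    by (auto intro!: derivative_eq_intros simp: wt_deriv_def power2_eq_square)
  then show ?thesis
    by (rule has_field_derivative_transform_within_open[where S = "{0<..}"])
       (use assms in \<open>auto simp: wt_def\<close>)
qed

lemma wt_mono: "wt r \<le> wt s" if "0 \<le> r" "r \<le> s" "s < pi"
proof (cases "r = 0")
  case True
  then show ?thesis using wt_ge_1[of s] that by (simp add: wt_def)
next
  case False
  show ?thesis
  proof (rule DERIV_nonneg_imp_nondecreasing[OF that(2)])
    fix t assume "r \<le> t" "t \<le> s"
    then show "\<exists>y. (wt has_real_derivative y) (at t) \<and> 0 \<le> y"
      using False that has_real_derivative_wt[of t] wt_deriv_nonneg[of t]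
      by (intro exI[of _ "wt_deriv t"]) auto
  qed
qed

text \<open>Convexity of \<open>r / sin r\<close>. The numerator of the second derivative factors as
  \<open>sin t * ((1 + (cos t)\<^sup>2) * t - 2 * cos t * sin t)\<close>, and the bracket is
  nonnegative because \<open>2 * cos t \<le> 1 + (cos t)\<^sup>2\<close> and
  \<open>sin t \<le> t\<close>.\<close>

lemma wt_deriv_mono: "wt_deriv r \<le> wt_deriv s" if "0 < r" "r \<le> s" "s < pi"
proof (rule DERIV_nonneg_imp_nondecreasing[OF that(2)])
  fix t assume t: "r \<le> t" "t \<le> s"
  then have st: "0 < sin t" using that by (intro sin_gt_zero) auto
  have "2 * cos t * sin t \<le> (1 + (cos t)\<^sup>2) * t"
  proof -
    have "2 * cos t * sin t \<le> (1 + (cos t)\<^sup>2) * sin t"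
      using st zero_le_power2[of "1 - cos t"]
      by (intro mult_right_mono) (auto simp: power2_eq_square algebra_simps)
    also have "\<dots> \<le> (1 + (cos t)\<^sup>2) * t"
      using sin_x_le_x[of t] t that by (intro mult_left_mono) auto
    finally show ?thesis .
  qed
  moreover have "(wt_deriv has_real_derivative
      (t * sin t * (sin t)\<^sup>2 - (sin t - t * cos t) * (2 * sin t * cos t)) / (sin t)\<^sup>2 ^ 2) (at t)"
    unfolding wt_deriv_def [abs_def] using st
    by (auto intro!: derivative_eq_intros simp: power2_eq_square)
  moreover have "(t * sin t * (sin t)\<^sup>2 - (sin t - t * cos t) * (2 * sin t * cos t))
      = sin t * ((1 + (cos t)\<^sup>2) * t - 2 * cos t * sin t)"
    unfolding sin_squared_eq by (simp add: algebra_simps power2_eq_square)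
  ultimately show "\<exists>y. (wt_deriv has_real_derivative y) (at t) \<and> 0 \<le> y"
    using st by (intro exI conjI) (auto)
qed

lemma wt_lipschitz_le:
  assumes "0 \<le> r" "r \<le> s" "s \<le> q" "q \<le> pi / 2"
  shows "wt s - wt r \<le> wt_deriv q * (s - r)"
proof -
  consider "r = s" | "r = 0" "r < s" | "0 < r" "r < s" using assms by linarith
  then show ?thesis
  proof cases
    case 1 then show ?thesis by simp
  next
    \<comment> \<open>The mean value theorem wants the derivative at both end points, and
      \<open>has_real_derivative_wt\<close> excludes 0. For the chord starting at 0 the bound by
      \<open>wt_deriv s\<close> amounts to \<open>s\<^sup>2 * cos s \<le> (sin s)\<^sup>2\<close>, a
      consequence of \<open>cubed_cos_le_sin_cubed\<close>.\<close>
    case 2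
    have s: "0 < s" "s < pi" using 2 assms pi_gt_zero by linarith+
    then have ss: "0 < sin s" by (intro sin_gt_zero) auto
    have "s\<^sup>2 * cos s * s \<le> sin s ^ 3"
      using cubed_cos_le_sin_cubed[of s] s assms pi_half_less by (auto simp: eval_nat_numeral mult_ac)
    also have "\<dots> \<le> (sin s)\<^sup>2 * s"
      using mult_left_mono[OF sin_x_le_x[of s], of "(sin s)\<^sup>2"] s by (simp add: eval_nat_numeral)
    finally have *: "s\<^sup>2 * cos s \<le> (sin s)\<^sup>2" using s by simp
    have "wt s - wt r = (s * sin s - (sin s)\<^sup>2) / (sin s)\<^sup>2"
      using 2 ss by (simp add: wt_def field_simps power2_eq_square)
    also have "\<dots> \<le> ((sin s - s * cos s) * s) / (sin s)\<^sup>2"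
      using * by (intro divide_right_mono) (auto simp: power2_eq_square algebra_simps)
    also have "\<dots> = wt_deriv s * (s - r)" using 2 by (simp add: wt_deriv_def)
    also have "\<dots> \<le> wt_deriv q * (s - r)"
      using wt_deriv_mono[of s q] s assms 2 by (intro mult_right_mono) auto
    finally show ?thesis .
  next
    case 3
    have "\<exists>z>r. z < s \<and> wt s - wt r = (s - r) * wt_deriv z"
      by (rule MVT2[OF 3(2)]) (use 3 assms in \<open>auto intro!: has_real_derivative_wt\<close>)
    then obtain z where z: "r < z" "z < s" "wt s - wt r = (s - r) * wt_deriv z" by blast
    have "wt_deriv z \<le> wt_deriv q" using wt_deriv_mono[of z q] z 3 assms pi_gt_zero by linarith
    then show ?thesis using z(3) 3 by (simp add: mult.commute mult_left_mono)
  qed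
qed

lemma wt_lipschitz:
  assumes "0 \<le> r" "r \<le> q" "0 \<le> s" "s \<le> q" "q \<le> pi / 2"
  shows "\<bar>wt s - wt r\<bar> \<le> wt_deriv q * \<bar>s - r\<bar>"
proof (cases "r \<le> s")
  case True
  then show ?thesis using wt_lipschitz_le[of r s q] wt_mono[of r s] assms pi_gt_zero by auto
next
  case False
  then show ?thesis using wt_lipschitz_le[of s r q] wt_mono[of s r] assms pi_gt_zero by auto
qed

text \<open>The function \<open>u \<mapsto> (arccos u)\<^sup>2\<close> is convex with derivative \<open>-2 wt (arccos u)\<close>; this is its tangent
  line inequality.\<close>

lemma square_tangent_cos:
  assumes "0 \<le> m" "m < pi" "0 \<le> t" "t < pi"
  shows "2 * wt m * (cos m - cos t) \<le> t\<^sup>2 - m\<^sup>2"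
proof -
  define f where "f x = x\<^sup>2 + 2 * wt m * cos x" for x
  \<comment> \<open>By monotonicity of \<open>wt\<close> this derivative has the sign of
    \<open>x - m\<close>, so \<open>f\<close> is smallest at \<open>m\<close>.\<close>
  have der: "(f has_real_derivative 2 * sin x * (wt x - wt m)) (at x)" if "0 \<le> x" "x < pi" for x
    unfolding f_def using that
    by (auto intro!: derivative_eq_intros simp: wt_mult_sin algebra_simps)
  have "f m \<le> f t"
  proof (cases "m \<le> t")
    case True
    show ?thesis
    proof (rule DERIV_nonneg_imp_nondecreasing[OF True])
      fix x assume "m \<le> x" "x \<le> t"
      then show "\<exists>y. (f has_real_derivative y) (at x) \<and> 0 \<le> y"
        using der[of x] wt_mono[of m x] sin_ge_zero[of x] assms
        by (intro exI[of _ "2 * sin x * (wt x - wt m)"]) auto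
    qed
  next
    case False
    show ?thesis
    proof (rule DERIV_nonpos_imp_nonincreasing[of t m])
      fix x assume "t \<le> x" "x \<le> m"
      then show "\<exists>y. (f has_real_derivative y) (at x) \<and> y \<le> 0"
        using der[of x] wt_mono[of x m] sin_ge_zero[of x] assms
        by (intro exI[of _ "2 * sin x * (wt x - wt m)"]) (auto intro!: mult_nonneg_nonpos)
    qed (use False in auto)
  qed
  then show ?thesis by (simp add: f_def algebra_simps)
qed

section \<open>The numerical constant\<close>

text \<open>Applied with \<open>\<tau> = tan R\<close>. Expanding the product gives four terms to be
  estimated jointly: with \<open>h = cos q * wt q\<close>, the sine times the derivative is
  \<open>1 - h\<close>, so that \<open>h + \<tau> * (1 - h) \<le> 1\<close>; the sine times the
  weight is exactly \<open>q\<close>; the cosine times the derivative is at most 1 / 3. This is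
  where the 4 / 3 of the final constant comes from.\<close>

lemma wt_plus_wt_deriv_bound:
  assumes "0 < q" "q \<le> pi / 2" "0 \<le> \<tau>" "\<tau> \<le> 1"
  shows "(cos q + \<tau> * sin q) * (wt q + wt_deriv q) \<le> 4 / 3 + \<tau> * q"
proof -
  have q: "q < pi" using assms pi_gt_zero by linarith
  have s: "0 < sin q" using assms q by (intro sin_gt_zero) auto
  have c: "0 \<le> cos q" using assms q by (intro cos_ge_zero) auto
  define h where "h = cos q * wt q"
  have h: "wt_deriv q * sin q = 1 - h"
    using s assms by (simp add: wt_deriv_def h_def wt_def field_simps power2_eq_square)
  have "0 \<le> (1 - h)"
    using wt_deriv_nonneg[of q] s q assms by (simp flip: h)
  then have 1: "h + \<tau> * (1 - h) \<le> 1" using mult_right_mono[of \<tau> 1 "1 - h"] assms by simp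
  have "wt_deriv q * cos q * (3 * (sin q)\<^sup>2) = 3 * (sin q - q * cos q) * cos q"
    using s by (simp add: wt_deriv_def field_simps)
  also have "\<dots> \<le> q ^ 3 * cos q"
    using sin_minus_cos_le_cubic[of q] assms by (intro mult_right_mono[OF _ c]) simp
  also have "\<dots> \<le> sin q ^ 3" using assms pi_half_less by (intro cubed_cos_le_sin_cubed) auto
  also have "\<dots> \<le> (sin q)\<^sup>2" using s by (simp add: eval_nat_numeral mult_left_le)
  finally have 2: "wt_deriv q * cos q \<le> 1 / 3" using s by simp
  have "(cos q + \<tau> * sin q) * (wt q + wt_deriv q)
      = h + \<tau> * (wt q * sin q) + wt_deriv q * cos q + \<tau> * (wt_deriv q * sin q)"
    by (simp add: h_def algebra_simps)
  also have "\<dots> = (h + \<tau> * (1 - h)) + \<tau> * q + wt_deriv q * cos q"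
    using assms q by (simp add: h wt_mult_sin)
  also have "\<dots> \<le> 4 / 3 + \<tau> * q" using 1 2 by simp
  finally show ?thesis .
qed

text \<open>The left-hand side equals \<open>(4 / 3) * wt R + 2 * R\<^sup>2 / cos R\<close> and is
  bounded through its Taylor majorant at the right end \<open>b\<close>, while \<epsilon> is bounded
  at the left end \<open>a\<close>. The claim on the interval thus becomes the rational inequality
  \<open>K ^ 4 * \<epsilon> \<le> 16\<close>.\<close>

lemma lipschitz_constant_bound_on:
  assumes "0 \<le> a" "a \<le> R" "R \<le> b" "b \<le> 4 / 5" "R < pi / 4" "\<epsilon> = pi / 2 - 2 * R"
    and K: "(4 / 3) / (1 - b\<^sup>2 / 6) + 2 * b\<^sup>2 / (1 - b\<^sup>2 / 2) \<le> K" "K ^ 4 * (8 / 5 - 2 * a) \<le> 16"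
  shows "wt R * (4 / 3 + 2 * R * tan R) \<le> 2 / \<epsilon> powr (1 / 4)"
proof -
  have R: "0 \<le> R" "R < pi / 2" using assms pi_gt_zero by linarith+
  have \<epsilon>: "0 < \<epsilon>" "\<epsilon> \<le> 8 / 5 - 2 * a" using assms pi_half_less by linarith+
  have Rb: "R\<^sup>2 \<le> b\<^sup>2" "b\<^sup>2 \<le> 16 / 25"
    using power_mono[of R b 2] power_mono[of b "4 / 5" 2] assms by (auto simp: power2_eq_square)
  have c: "0 < cos R" using R by (intro cos_gt_zero_pi) auto
  have "1 / cos R \<le> 1 / (1 - b\<^sup>2 / 2)"
    using cos_ge_quadratic[OF R(1)] Rb c by (intro divide_left_mono) auto
  moreover have w: "wt R \<le> 1 / (1 - b\<^sup>2 / 6)"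
  proof (cases "R = 0")
    case False
    have "R * (1 - R\<^sup>2 / 6) \<le> sin R"
      using sin_ge_cubic[OF R(1)] by (simp add: algebra_simps eval_nat_numeral)
    then have "R * (1 - b\<^sup>2 / 6) \<le> sin R"
      using Rb mult_left_mono[of "1 - b\<^sup>2 / 6" "1 - R\<^sup>2 / 6" R] R by linarith
    then show ?thesis
      using False R Rb sin_gt_zero[of R] by (simp add: wt_def field_simps)
  qed (use Rb in \<open>simp add: wt_def\<close>)
  ultimately have "(4 / 3) * wt R + 2 * R\<^sup>2 * (1 / cos R)
      \<le> (4 / 3) * (1 / (1 - b\<^sup>2 / 6)) + 2 * b\<^sup>2 * (1 / (1 - b\<^sup>2 / 2))"
    using Rb c wt_ge_1[of R] R by (intro add_mono mult_mono) auto
  moreover have "wt R * (4 / 3 + 2 * R * tan R) = (4 / 3) * wt R + 2 * R\<^sup>2 * (1 / cos R)"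
    using wt_mult_sin[of R] R by (simp add: tan_def algebra_simps power2_eq_square)
  ultimately have le: "wt R * (4 / 3 + 2 * R * tan R) \<le> K" using K by simp
  have "0 \<le> wt R" using wt_ge_1[of R] R by simp
  moreover have "0 \<le> tan R" using R c sin_ge_zero[of R] by (simp add: tan_def)
  ultimately have K0: "0 \<le> K"
    using le R by (smt (verit) mult_nonneg_nonneg zero_le_divide_iff)
  have "(K * \<epsilon> powr (1 / 4)) ^ 4 = K ^ 4 * \<epsilon>"
    using \<epsilon> powr_power[of \<epsilon> "1 / 4" 4] by (simp add: power_mult_distrib)
  also have "\<dots> \<le> K ^ 4 * (8 / 5 - 2 * a)" using \<epsilon> by (intro mult_left_mono) auto
  also have "\<dots> \<le> 2 ^ 4" using K by simp
  finally have "K * \<epsilon> powr (1 / 4) \<le> 2" by (rule power_mono_iff[THEN iffD1, rotated 3]) (use K0 in auto)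
  then show ?thesis using le \<epsilon> by (simp add: pos_le_divide_eq order_trans[OF mult_right_mono])
qed

text \<open>The left side stays bounded up to pi / 4 and the right side blows up there, but the
  ratio of the two rises to about 0.9 near \<open>R = 0.64\<close>, so the range is cut into short
  intervals. Each \<open>K\<close> is the majorant at the right end, rounded up.\<close>

lemma lipschitz_constant_bound:
  assumes "0 \<le> R" "R < pi / 4" "\<epsilon> = pi / 2 - 2 * R"
  shows "wt R * (4 / 3 + 2 * R * tan R) \<le> 2 / \<epsilon> powr (1 / 4)"
proof -
  note * = lipschitz_constant_bound_on[OF _ _ _ _ assms(2,3)]
  have "R \<le> 4 / 5" using assms pi_half_less by linarith
  then consider "R \<le> 42/100" | "42/100 \<le> R" "R \<le> 55/100" | "55/100 \<le> R" "R \<le> 61/100"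
    | "61/100 \<le> R" "R \<le> 655/1000" | "655/1000 \<le> R" "R \<le> 69/100"
    | "69/100 \<le> R" "R \<le> 73/100" | "73/100 \<le> R" "R \<le> 77/100" | "77/100 \<le> R" "R \<le> 4/5"
    by linarith
  then show ?thesis
  proof cases
    case 1 then show ?thesis
      using assms by (intro *[of 0 "42/100" "177/100"]) (auto simp: power_divide)
  next
    case 2 then show ?thesis
      by (intro *[of "42/100" "55/100" "213/100"]) (auto simp: power_divide)
  next
    case 3 then show ?thesis
      by (intro *[of "55/100" "61/100" "236/100"]) (auto simp: power_divide)
  next
    case 4 then show ?thesis
      by (intro *[of "61/100" "655/1000" "254/100"]) (auto simp: power_divide)
  next
    case 5 then show ?thesis
      by (intro *[of "655/1000" "69/100" "271/100"]) (auto simp: power_divide)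
  next
    case 6 then show ?thesis
      by (intro *[of "69/100" "73/100" "2918/1000"]) (auto simp: power_divide)
  next
    case 7 then show ?thesis
      by (intro *[of "73/100" "77/100" "32/10"]) (auto simp: power_divide)
  next
    case 8 then show ?thesis
      by (intro *[of "77/100" "4/5" "34/10"]) (auto simp: power_divide)
  qed
qed

section \<open>Comparison triangles in the model planes\<close>

text \<open>\<open>t\<close> is the cosine of the angle between the sides \<open>c\<close> and
  \<open>a\<close>, read off from the law of cosines. The triangle inequalities give
  \<open>t \<le> 1\<close>, and the perimeter bound gives \<open>t \<ge> -1\<close> when
  \<open>c + a\<close> exceeds pi. If a side degenerates the angle is arbitrary and 0 is
  taken.\<close>

lemma exists_cosine_spherical:
  assumes "0 \<le> a" "a < pi" "0 \<le> b" "b < pi" "0 \<le> c" "c < pi"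
    "a \<le> b + c" "b \<le> a + c" "c \<le> a + b" "a + b + c < 2 * pi"
  shows "\<exists>t. \<bar>t\<bar> \<le> 1 \<and> cos c * cos a + sin c * sin a * t = cos (b::real)"
proof (cases "sin c * sin a = 0")
  case True
  then have "c = 0 \<or> a = 0"
    using sin_gt_zero[of a] sin_gt_zero[of c] assms by force
  then have "cos c * cos a = cos b" using assms by auto
  with True show ?thesis by (intro exI[of _ 0]) auto
next
  case False
  then have pos: "0 < sin c * sin a"
    using sin_ge_zero[of a] sin_ge_zero[of c] assms by (metis less_eq_real_def mult_nonneg_nonneg)
  define t where "t = (cos b - cos c * cos a) / (sin c * sin a)"
  have "cos b \<le> cos \<bar>c - a\<bar>" using assms by (intro cos_monotone_0_pi_le) auto
  then have "cos b \<le> cos (c - a)" by (simp add: cos_abs_real)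
  moreover have "cos (c + a) \<le> cos b"
  proof (cases "c + a \<le> pi")
    case True
    then show ?thesis using assms by (intro cos_monotone_0_pi_le) auto
  next
    case False
    have "cos (2 * pi - (c + a)) \<le> cos b"
      using assms False by (intro cos_monotone_0_pi_le) auto
    then show ?thesis by (simp add: cos_diff)
  qed
  ultimately have "\<bar>t\<bar> \<le> 1"
    using pos by (auto simp: t_def abs_le_iff divide_simps cos_diff cos_add algebra_simps)
  moreover have "cos c * cos a + sin c * sin a * t = cos b"
    using False by (simp add: t_def)
  ultimately show ?thesis by blast
qed

lemma exists_cosine_hyperbolic:
  assumes "0 \<le> a" "0 \<le> b" "0 \<le> c" "a \<le> b + c" "b \<le> a + c" "c \<le> a + b"
  shows "\<exists>t. \<bar>t\<bar> \<le> 1 \<and> cosh c * cosh a - sinh c * sinh a * t = cosh (b::real)"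
proof (cases "sinh c * sinh a = 0")
  case True
  then have "c = 0 \<or> a = 0" by auto
  then have "cosh c * cosh a = cosh b" using assms by auto
  with True show ?thesis by (intro exI[of _ 0]) auto
next
  case False
  then have pos: "0 < sinh c * sinh a" using assms by (simp add: less_le)
  define t where "t = (cosh c * cosh a - cosh b) / (sinh c * sinh a)"
  have "cosh \<bar>c - a\<bar> \<le> cosh b" using assms by (subst cosh_real_nonneg_le_iff) auto
  then have "cosh (c - a) \<le> cosh b" by simp
  moreover have "cosh b \<le> cosh (c + a)"
    using assms by (subst cosh_real_nonneg_le_iff) auto
  ultimately have "\<bar>t\<bar> \<le> 1"
    using pos by (auto simp: t_def abs_le_iff divide_simps cosh_diff cosh_add algebra_simps)
  moreover have "cosh c * cosh a - sinh c * sinh a * t = cosh b"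
    using False by (simp add: t_def)
  ultimately show ?thesis by blast
qed

lemma exists_cosine_euclidean:
  assumes "0 \<le> a" "0 \<le> b" "0 \<le> c" "a \<le> b + c" "b \<le> a + c" "c \<le> a + b"
  shows "\<exists>t. \<bar>t\<bar> \<le> 1 \<and> c\<^sup>2 + a\<^sup>2 - 2 * c * a * t = (b::real)\<^sup>2"
proof (cases "c * a = 0")
  case True
  then have "c\<^sup>2 + a\<^sup>2 = b\<^sup>2" using assms by auto
  with True show ?thesis by (intro exI[of _ 0]) auto
next
  case False
  then have pos: "0 < c * a" using assms by (simp add: less_le)
  define t where "t = (c\<^sup>2 + a\<^sup>2 - b\<^sup>2) / (2 * c * a)"
  have "(c - a)\<^sup>2 \<le> b\<^sup>2" using assms by (intro power2_le_iff_abs_le[THEN iffD2]) auto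
  moreover have "b\<^sup>2 \<le> (c + a)\<^sup>2" using assms by (intro power_mono) auto
  ultimately have "\<bar>t\<bar> \<le> 1"
    using pos by (auto simp: t_def abs_le_iff divide_simps power2_eq_square algebra_simps)
  moreover have "c\<^sup>2 + a\<^sup>2 - 2 * c * a * t = b\<^sup>2"
    using False by (simp add: t_def)
  ultimately show ?thesis by blast
qed

section \<open>Explicit geodesics in the model planes\<close>

text \<open>Up to the factor \<open>(sin c)\<^sup>2\<close> this is the inner product of the points
  at times \<open>s\<close> and \<open>t\<close> on the unit speed arc of length \<open>c\<close>,
  computed from the inner products of its end points.\<close>

lemma sin_arc_identity:
  "sin (c - s) * sin (c - t) + sin s * sin t + cos c * (sin (c - s) * sin t + sin s * sin (c - t))
    = (sin c)\<^sup>2 * cos (s - t :: real)"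
proof -
  have "(cos c)\<^sup>2 = 1 - (sin c)\<^sup>2" by (simp add: cos_squared_eq)
  then show ?thesis unfolding sin_diff cos_diff by algebra
qed

lemma sinh_arc_identity:
  "sinh (c - s) * sinh (c - t) + sinh s * sinh t + cosh c * (sinh (c - s) * sinh t + sinh s * sinh (c - t))
    = (sinh c)\<^sup>2 * cosh (s - t :: real)"
proof -
  have "(cosh c)\<^sup>2 = 1 + (sinh c)\<^sup>2" by (simp add: cosh_square_eq)
  then show ?thesis unfolding sinh_diff cosh_diff by algebra
qed

text \<open>Spherical linear interpolation. The last clause is the reason for recording the arc: it
  gives the cosine of the distance to any \<open>w\<close> from the end points alone. It is
  multiplied by \<open>sin (k * c)\<close> so that it also covers \<open>c = 0\<close>.\<close>

lemma sphere_arc: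
  fixes u v :: "real^3"
  assumes "0 < k" "norm u = 1" "norm v = 1" "0 \<le> c" "k * c < pi" "u \<bullet> v = cos (k * c)"
  shows "\<exists>\<gamma>. \<gamma> 0 = u \<and> \<gamma> c = v \<and>
    (\<forall>s\<in>{0..c}. norm (\<gamma> s) = 1 \<and> (\<forall>t\<in>{0..c}. arccos (\<gamma> s \<bullet> \<gamma> t) / k = \<bar>s - t\<bar>) \<and>
      (\<forall>w. sin (k * c) * (\<gamma> s \<bullet> w) = sin (k * (c - s)) * (u \<bullet> w) + sin (k * s) * (v \<bullet> w)))"
proof (cases "c = 0")
  case True
  then have "u \<bullet> v = 1" "u \<bullet> u = 1" "v \<bullet> v = 1" using assms by (auto simp: norm_eq_1)
  then have "(u - v) \<bullet> (u - v) = 0" by (simp add: inner_diff_left inner_diff_right inner_commute)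
  then have "u = v" by simp
  then show ?thesis using True assms by (intro exI[of _ "\<lambda>_. u"]) (auto simp: norm_eq_1)
next
  case False
  define S where "S = sin (k * c)"
  have S: "0 < S" using assms False by (auto simp: S_def intro!: sin_gt_zero)
  define \<gamma> where "\<gamma> s = (sin (k * (c - s)) / S) *\<^sub>R u + (sin (k * s) / S) *\<^sub>R v" for s
  have uv: "u \<bullet> u = 1" "v \<bullet> v = 1" "v \<bullet> u = cos (k * c)"
    using assms by (auto simp: norm_eq_1 inner_commute)
  have lin: "S * (\<gamma> s \<bullet> w) = sin (k * (c - s)) * (u \<bullet> w) + sin (k * s) * (v \<bullet> w)" for s w
    using S by (simp add: \<gamma>_def inner_add_left field_simps)
  have "S\<^sup>2 * (\<gamma> s \<bullet> \<gamma> t) = S\<^sup>2 * cos (k * s - k * t)" for s t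
  proof -
    have "S\<^sup>2 * (\<gamma> s \<bullet> \<gamma> t) = sin (k * (c - s)) * (S * (\<gamma> t \<bullet> u)) + sin (k * s) * (S * (\<gamma> t \<bullet> v))"
      using lin[of s "\<gamma> t"] by (simp add: power2_eq_square inner_commute algebra_simps)
    also have "\<dots> = S\<^sup>2 * cos (k * s - k * t)"
      using sin_arc_identity[of "k * c" "k * s" "k * t"] unfolding lin uv assms(6) unfolding S_def
      by (simp add: algebra_simps)
    finally show ?thesis .
  qed
  then have inner: "\<gamma> s \<bullet> \<gamma> t = cos (k * (s - t))" for s t
    using S by (simp add: algebra_simps)
  have "arccos (\<gamma> s \<bullet> \<gamma> t) / k = \<bar>s - t\<bar>" if "s \<in> {0..c}" "t \<in> {0..c}" for s t
  proof -
    have "k * \<bar>s - t\<bar> \<le> k * c" using that assms by (intro mult_left_mono) auto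
    then have "\<bar>k * (s - t)\<bar> \<le> pi" using assms by (simp only: abs_mult)
    then show ?thesis using assms by (simp add: inner arccos_cos_eq_abs abs_mult)
  qed
  moreover have "norm (\<gamma> s) = 1" for s by (simp add: norm_eq_1 inner)
  moreover have "\<gamma> 0 = u" "\<gamma> c = v" using S by (auto simp: \<gamma>_def S_def[symmetric])
  ultimately show ?thesis
    using lin unfolding S_def[symmetric] by (intro exI[of _ \<gamma>]) auto
qed

text \<open>Signature \<open>(-, -, +)\<close>: the hyperboloid model is \<open>minkowski u u = 1\<close>, \<open>0 < u$3\<close>.\<close>

definition minkowski :: "real^3 \<Rightarrow> real^3 \<Rightarrow> real" where
  "minkowski u v = u$3 * v$3 - u$1 * v$1 - u$2 * v$2"

lemma minkowski_simps:
  "minkowski (u + v) w = minkowski u w + minkowski v w"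
  "minkowski (r *\<^sub>R u) w = r * minkowski u w"
  "minkowski u w = minkowski w u" 
  by (auto simp: minkowski_def algebra_simps)

text \<open>The equality case of the reversed Cauchy-Schwarz inequality. By the Lagrange identity
  the defect is a sum of three squares, all of which vanish.\<close>

lemma hyperboloid_eq_iff:
  fixes u v :: "real^3"
  assumes "minkowski u u = 1" "minkowski v v = 1" "minkowski u v = 1" "0 < u$3" "0 < v$3"
  shows "u = v"
proof -
  define a b c d e f where "a = u$1" "b = u$2" "c = u$3" "d = v$1" "e = v$2" "f = v$3"
  note defs = this
  have cf: "c\<^sup>2 = 1 + a\<^sup>2 + b\<^sup>2" "f\<^sup>2 = 1 + d\<^sup>2 + e\<^sup>2" "c * f = 1 + a * d + b * e"
    using assms(1-3) by (auto simp: minkowski_def defs power2_eq_square algebra_simps)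
  have "(1 + a * d + b * e)\<^sup>2 = (1 + a\<^sup>2 + b\<^sup>2) * (1 + d\<^sup>2 + e\<^sup>2)"
    unfolding cf[symmetric] by (simp add: power_mult_distrib)
  then have "(a - d)\<^sup>2 + (b - e)\<^sup>2 + (a * e - b * d)\<^sup>2 = 0"
    by (simp add: power2_eq_square algebra_simps)
  then have "(a - d)\<^sup>2 = 0" "(b - e)\<^sup>2 = 0"
    using zero_le_power2[of "a - d"] zero_le_power2[of "b - e"] zero_le_power2[of "a * e - b * d"]
    by linarith+
  then have "a = d" "b = e" by simp_all
  moreover have "c = f"
    by (rule power2_eq_imp_eq) (use cf(1,2) assms(4,5) \<open>a = d\<close> \<open>b = e\<close> in \<open>simp_all add: defs\<close>)
  ultimately show ?thesis by (auto simp: vec_eq_iff forall_3 defs)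
qed

lemma hyperboloid_arc:
  fixes u v :: "real^3"
  assumes "0 < k" "minkowski u u = 1" "minkowski v v = 1" "0 < u$3" "0 < v$3"
    "0 \<le> c" "minkowski u v = cosh (k * c)"
  shows "\<exists>\<gamma>. \<gamma> 0 = u \<and> \<gamma> c = v \<and>
    (\<forall>s\<in>{0..c}. minkowski (\<gamma> s) (\<gamma> s) = 1 \<and> 0 < \<gamma> s $ 3 \<and>
      (\<forall>t\<in>{0..c}. arcosh (minkowski (\<gamma> s) (\<gamma> t)) / k = \<bar>s - t\<bar>) \<and>
      (\<forall>w. sinh (k * c) * minkowski (\<gamma> s) w
         = sinh (k * (c - s)) * minkowski u w + sinh (k * s) * minkowski v w))"
proof (cases "c = 0")
  case True
  then have "u = v" using assms by (intro hyperboloid_eq_iff) auto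
  then show ?thesis using True assms by (intro exI[of _ "\<lambda>_. u"]) auto
next
  case False
  define S where "S = sinh (k * c)"
  have S: "0 < S" using assms False by (auto simp: S_def)
  define \<gamma> where "\<gamma> s = (sinh (k * (c - s)) / S) *\<^sub>R u + (sinh (k * s) / S) *\<^sub>R v" for s
  have lin: "S * minkowski (\<gamma> s) w = sinh (k * (c - s)) * minkowski u w + sinh (k * s) * minkowski v w" for s w
    using S by (simp add: \<gamma>_def minkowski_simps(1,2) field_simps)
  have vu: "minkowski v u = cosh (k * c)" using assms minkowski_simps(3) by metis
  have "S\<^sup>2 * minkowski (\<gamma> s) (\<gamma> t) = S\<^sup>2 * cosh (k * s - k * t)" for s t
  proof -
    have "S\<^sup>2 * minkowski (\<gamma> s) (\<gamma> t)
        = sinh (k * (c - s)) * (S * minkowski (\<gamma> t) u) + sinh (k * s) * (S * minkowski (\<gamma> t) v)"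
      using lin[of s "\<gamma> t"] minkowski_simps(3)[of "\<gamma> t"] by (simp add: power2_eq_square algebra_simps)
    also have "\<dots> = S\<^sup>2 * cosh (k * s - k * t)"
      using sinh_arc_identity[of "k * c" "k * s" "k * t"] unfolding lin vu assms(2,3,7) unfolding S_def
      by (simp add: algebra_simps)
    finally show ?thesis .
  qed
  then have form: "minkowski (\<gamma> s) (\<gamma> t) = cosh (k * (s - t))" for s t
    using S by (simp add: algebra_simps)
  have "arcosh (minkowski (\<gamma> s) (\<gamma> t)) / k = \<bar>s - t\<bar>" for s t
  proof -
    have "arcosh (cosh (k * (s - t))) = arcosh (cosh \<bar>k * (s - t)\<bar>)" by simp
    also have "\<dots> = k * \<bar>s - t\<bar>" using assms by (subst arcosh_cosh_real) (auto simp: abs_mult)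
    finally show ?thesis using assms by (simp add: form)
  qed
  moreover have "0 < \<gamma> s $ 3" if "s \<in> {0..c}" for s
  proof (cases "s = 0")
    case True
    then show ?thesis using S assms by (simp add: \<gamma>_def S_def[symmetric])
  next
    case False
    then show ?thesis
      using S assms that unfolding \<gamma>_def
      by (auto intro!: add_nonneg_pos mult_pos_pos mult_nonneg_nonneg divide_nonneg_pos divide_pos_pos)
  qed
  moreover have "\<gamma> 0 = u" "\<gamma> c = v" using S by (auto simp: \<gamma>_def S_def[symmetric])
  ultimately show ?thesis
    using lin unfolding S_def[symmetric] by (intro exI[of _ \<gamma>]) (auto simp: form)
qed

section \<open>Explicit comparison inequalities\<close>

text \<open>The CAT condition is used only in this form, for a point on one side and the opposite
  vertex. The given geodesic is kept as side 0; the other two sides are arbitrary geodesics supplied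
  by the space.\<close>

lemma CAT_vertex_comparison:
  fixes M :: "'a::metric_space set"
  assumes "CAT \<kappa> M" "x \<in> M" "y \<in> M" "z \<in> M" "geodesic_between M dist \<gamma> y z"
    and per: "\<kappa> \<le> 0 \<or> dist y z + dist z x + dist x y < 2 * Dk \<kappa>"
    and mem: "yb \<in> model_space \<kappa>" "zb \<in> model_space \<kappa>" "xb \<in> model_space \<kappa>"
    and dists: "model_dist \<kappa> yb zb = dist y z" "model_dist \<kappa> zb xb = dist z x"
      "model_dist \<kappa> xb yb = dist x y"
    and geo: "geodesic_between (model_space \<kappa>) (model_dist \<kappa>) \<gamma>b yb zb"
      "geodesic_between (model_space \<kappa>) (model_dist \<kappa>) \<gamma>' zb xb"
      "geodesic_between (model_space \<kappa>) (model_dist \<kappa>) \<gamma>'' xb yb"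
    and s: "s \<in> {0..dist y z}"
  shows "dist (\<gamma> s) x \<le> model_dist \<kappa> (\<gamma>b s) xb"
proof -
  have all3: "(\<forall>i<3::nat. P i) \<longleftrightarrow> P 0 \<and> P 1 \<and> P 2" for P
    by (auto simp: numeral_3_eq_3 less_Suc_eq numeral_2_eq_2)
  have M: "geodesic_space M" using assms(1) by (simp add: CAT_def)
  obtain g where "geodesic_between M dist g z x"
    using M assms(2,4) unfolding geodesic_space_def by blast
  moreover obtain h where "geodesic_between M dist h x y"
    using M assms(2,3) unfolding geodesic_space_def by blast
  ultimately have gh: "geodesic_between M dist g z x" "geodesic_between M dist h x y" .
  have sum3: "(\<Sum>i<3::nat. f i) = f 0 + f 1 + f 2" for f :: "nat \<Rightarrow> real"
    by (simp add: numeral_3_eq_3 numeral_2_eq_2)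
  have mod3: "Suc 0 mod 3 = 1" "Suc 1 mod 3 = 2" "Suc 2 mod 3 = 0" by simp_all
  define V where "V i = (if i = 0 then y else if i = 1 then z else x)" for i :: nat
  define G where "G i = (if i = 0 then \<gamma> else if i = 1 then g else h)" for i :: nat
  define Vb where "Vb i = (if i = 0 then yb else if i = 1 then zb else xb)" for i :: nat
  define Gb where "Gb i = (if i = 0 then \<gamma>b else if i = 1 then \<gamma>' else \<gamma>'')" for i :: nat
  have h1: "\<forall>i<3. V i \<in> M \<and> geodesic_between M dist (G i) (V i) (V (Suc i mod 3))"
    unfolding all3 mod3 using assms gh by (simp add: V_def G_def)
  have h2: "\<kappa> \<le> 0 \<or> (\<Sum>i<3. dist (V i) (V (Suc i mod 3))) < 2 * Dk \<kappa>"
    unfolding sum3 mod3 using per by (simp add: V_def)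
  have h3: "\<forall>i<3. Vb i \<in> model_space \<kappa> \<and>
              model_dist \<kappa> (Vb i) (Vb (Suc i mod 3)) = dist (V i) (V (Suc i mod 3)) \<and>
              geodesic_between (model_space \<kappa>) (model_dist \<kappa>) (Gb i) (Vb i) (Vb (Suc i mod 3))"
    unfolding all3 mod3 using mem dists geo by (simp add: V_def Vb_def Gb_def)
  have "\<forall>i<3. \<forall>j<3. \<forall>s\<in>{0..dist (V i) (V (Suc i mod 3))}. \<forall>t\<in>{0..dist (V j) (V (Suc j mod 3))}.
          dist (G i s) (G j t) \<le> model_dist \<kappa> (Gb i s) (Gb j t)"
    by (rule assms(1)[unfolded CAT_def, THEN conjunct2, THEN conjunct2, THEN spec[of _ V],
        THEN spec[of _ G], THEN spec[of _ Vb], THEN spec[of _ Gb], THEN mp, OF conjI[OF h1 conjI[OF h2 h3]]])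
  \<comment> \<open>Side 2 starts at \<open>x\<close>, so its parameter 0 is the vertex opposite to
    side 0.\<close>
  from this[rule_format, of 0 2 s 0] have "dist (\<gamma> s) (h 0) \<le> model_dist \<kappa> (\<gamma>b s) (\<gamma>'' 0)"
    unfolding mod3 using s by (simp add: V_def G_def Gb_def)
  moreover have "h 0 = x" "\<gamma>'' 0 = xb" using gh(2) geo(3) by (simp_all add: geodesic_between_def)
  ultimately show ?thesis by simp
qed

lemma norm_vec3: "norm (v::real^3) = 1 \<longleftrightarrow> (v$1)\<^sup>2 + (v$2)\<^sup>2 + (v$3)\<^sup>2 = 1"
  by (simp add: norm_eq_1 inner_vec_def sum_3 power2_eq_square)

lemma sphere_geodesic:
  assumes "0 < \<kappa>" "norm u = 1" "norm v = 1" "0 \<le> c" "sqrt \<kappa> * c < pi" "u \<bullet> v = cos (sqrt \<kappa> * c)"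
  shows "model_dist \<kappa> u v = c \<and>
    (\<exists>\<gamma>. geodesic_between (model_space \<kappa>) (model_dist \<kappa>) \<gamma> u v \<and>
      (\<forall>s\<in>{0..c}. norm (\<gamma> s) = 1 \<and>
        (\<forall>w. sin (sqrt \<kappa> * c) * (\<gamma> s \<bullet> w)
           = sin (sqrt \<kappa> * (c - s)) * (u \<bullet> w) + sin (sqrt \<kappa> * s) * (v \<bullet> w))))"
proof
  show d: "model_dist \<kappa> u v = c"
    using assms by (simp add: model_dist_def arccos_cos)
  obtain \<gamma> where \<gamma>: "\<gamma> 0 = u" "\<gamma> c = v"
    "\<forall>s\<in>{0..c}. norm (\<gamma> s) = 1 \<and> (\<forall>t\<in>{0..c}. arccos (\<gamma> s \<bullet> \<gamma> t) / sqrt \<kappa> = \<bar>s - t\<bar>) \<and>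
      (\<forall>w. sin (sqrt \<kappa> * c) * (\<gamma> s \<bullet> w) = sin (sqrt \<kappa> * (c - s)) * (u \<bullet> w) + sin (sqrt \<kappa> * s) * (v \<bullet> w))"
    using sphere_arc[of "sqrt \<kappa>" u v c] assms by auto
  have "geodesic_between (model_space \<kappa>) (model_dist \<kappa>) \<gamma> u v"
    using \<gamma> assms(1) unfolding geodesic_between_def d by (auto simp: model_space_def model_dist_def)
  with \<gamma>(3) show "\<exists>\<gamma>. geodesic_between (model_space \<kappa>) (model_dist \<kappa>) \<gamma> u v \<and>
      (\<forall>s\<in>{0..c}. norm (\<gamma> s) = 1 \<and>
        (\<forall>w. sin (sqrt \<kappa> * c) * (\<gamma> s \<bullet> w)
           = sin (sqrt \<kappa> * (c - s)) * (u \<bullet> w) + sin (sqrt \<kappa> * s) * (v \<bullet> w)))"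
    by blast
qed

text \<open>In the sphere this is an equality, namely the linear clause of the interpolated arc
  paired with the third vertex. A smaller distance has a larger cosine, hence the direction of the
  inequality.\<close>

lemma CAT_spherical_comparison:
  fixes M :: "'a::metric_space set"
  assumes "CAT \<kappa> M" "0 < \<kappa>" "x \<in> M" "y \<in> M" "z \<in> M" "geodesic_between M dist \<gamma> y z"
    and per: "sqrt \<kappa> * (dist x y + dist y z + dist z x) < 2 * pi"
    and s: "s \<in> {0..dist y z}"
  shows "sin (sqrt \<kappa> * (dist y z - s)) * cos (sqrt \<kappa> * dist y x) + sin (sqrt \<kappa> * s) * cos (sqrt \<kappa> * dist z x)
    \<le> sin (sqrt \<kappa> * dist y z) * cos (sqrt \<kappa> * dist (\<gamma> s) x)"
proof -
  define k where "k = sqrt \<kappa>"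
  have k: "0 < k" using assms by (simp add: k_def)
  define a b c where "a = k * dist x y" "b = k * dist z x" "c = k * dist y z"
  note abc = this
  have abc0: "0 \<le> a" "0 \<le> b" "0 \<le> c" using k by (auto simp: abc)
  have tri: "a \<le> b + c" "b \<le> a + c" "c \<le> a + b"
    unfolding abc distrib_left[symmetric] using k
    by (metis dist_commute dist_triangle add.commute mult_le_cancel_left_pos)+
  have per': "a + b + c < 2 * pi" using per by (simp add: abc k_def algebra_simps)
  \<comment> \<open>Each side is at most half the perimeter, hence shorter than pi.\<close>
  have pis: "a < pi" "b < pi" "c < pi" using tri per' by linarith+
  obtain t where t: "\<bar>t\<bar> \<le> 1" "cos c * cos a + sin c * sin a * t = cos b"
    using exists_cosine_spherical[of a b c] abc0 tri per' pis by auto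
  have t2: "t\<^sup>2 \<le> 1" using t(1) by (simp add: abs_square_le_1)
  \<comment> \<open>The comparison triangle has \<open>yb\<close> on the first axis and
    \<open>zb\<close> in the plane of the first two; the direction from \<open>yb\<close> to
    \<open>xb\<close> makes an angle of cosine \<open>t\<close> with that towards
    \<open>zb\<close>.\<close>
  define yb zb xb :: "real^3" where "yb = vector [1, 0, 0]" "zb = vector [cos c, sin c, 0]"
    "xb = vector [cos a, sin a * t, sin a * sqrt (1 - t\<^sup>2)]"
  note defs = this
  have n: "norm yb = 1" "norm zb = 1" "norm xb = 1"
    unfolding norm_vec3 using t2 sin_squared_eq[of a]
    by (auto simp: defs power_mult_distrib algebra_simps)
  have i: "yb \<bullet> zb = cos c" "zb \<bullet> xb = cos b" "xb \<bullet> yb = cos a"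
    using t(2) by (auto simp: defs inner_vec_def sum_3)
  obtain \<gamma>b where \<gamma>b: "geodesic_between (model_space \<kappa>) (model_dist \<kappa>) \<gamma>b yb zb"
      "norm (\<gamma>b s) = 1" "sin c * (\<gamma>b s \<bullet> xb) = sin (k * (dist y z - s)) * (yb \<bullet> xb) + sin (k * s) * (zb \<bullet> xb)"
    and d1: "model_dist \<kappa> yb zb = dist y z"
    using sphere_geodesic[of \<kappa> yb zb "dist y z"] n i assms(2) pis s unfolding abc k_def by auto
  obtain \<gamma>' where \<gamma>': "geodesic_between (model_space \<kappa>) (model_dist \<kappa>) \<gamma>' zb xb"
    and d2: "model_dist \<kappa> zb xb = dist z x"
    using sphere_geodesic[of \<kappa> zb xb "dist z x"] n i assms(2) pis unfolding abc k_def by auto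
  obtain \<gamma>'' where \<gamma>'': "geodesic_between (model_space \<kappa>) (model_dist \<kappa>) \<gamma>'' xb yb"
    and d3: "model_dist \<kappa> xb yb = dist x y"
    using sphere_geodesic[of \<kappa> xb yb "dist x y"] n i assms(2) pis unfolding abc k_def by auto
  have "dist (\<gamma> s) x \<le> model_dist \<kappa> (\<gamma>b s) xb"
  proof (rule CAT_vertex_comparison[OF assms(1,3-6) _ _ _ _ d1 d2 d3 \<gamma>b(1) \<gamma>' \<gamma>'' s])
    show "\<kappa> \<le> 0 \<or> dist y z + dist z x + dist x y < 2 * Dk \<kappa>"
      using per assms(2) by (simp add: Dk_def field_simps)
  qed (use n assms(2) in \<open>auto simp: model_space_def\<close>)
  then have "k * dist (\<gamma> s) x \<le> arccos (\<gamma>b s \<bullet> xb)"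
    using assms(2) by (simp add: model_dist_def k_def field_simps)
  moreover have I: "\<bar>\<gamma>b s \<bullet> xb\<bar> \<le> 1" using Cauchy_Schwarz_ineq2[of "\<gamma>b s" xb] n \<gamma>b(2) by simp
  ultimately have "cos (arccos (\<gamma>b s \<bullet> xb)) \<le> cos (k * dist (\<gamma> s) x)"
    using k by (intro cos_monotone_0_pi_le) (auto intro!: arccos_ubound simp: abs_le_iff)
  then have "\<gamma>b s \<bullet> xb \<le> cos (k * dist (\<gamma> s) x)" using I by (simp add: abs_le_iff cos_arccos)
  then have "sin c * (\<gamma>b s \<bullet> xb) \<le> sin c * cos (k * dist (\<gamma> s) x)"
    using abc0 pis by (intro mult_left_mono sin_ge_zero) auto
  then show ?thesis
    unfolding \<gamma>b(3) using i by (simp add: inner_commute abc k_def dist_commute)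
qed

text \<open>The reversed Cauchy-Schwarz inequality, by the identity that settles
  \<open>hyperboloid_eq_iff\<close>. It puts the argument of \<open>arcosh\<close> into its
  domain.\<close>

lemma minkowski_ge_1:
  fixes u v :: "real^3"
  assumes "minkowski u u = 1" "minkowski v v = 1" "0 < u$3" "0 < v$3"
  shows "1 \<le> minkowski u v"
proof -
  define a b c d e f where "a = u$1" "b = u$2" "c = u$3" "d = v$1" "e = v$2" "f = v$3"
  note defs = this
  have cf: "c\<^sup>2 = 1 + a\<^sup>2 + b\<^sup>2" "f\<^sup>2 = 1 + d\<^sup>2 + e\<^sup>2"
    using assms(1,2) by (auto simp: minkowski_def defs power2_eq_square algebra_simps)
  have "(c * f)\<^sup>2 = (1 + a * d + b * e)\<^sup>2 + ((a - d)\<^sup>2 + (b - e)\<^sup>2 + (a * e - b * d)\<^sup>2)"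
    unfolding power_mult_distrib cf by (simp add: power2_eq_square algebra_simps)
  then have "(1 + a * d + b * e)\<^sup>2 \<le> (c * f)\<^sup>2" by simp
  moreover have "0 \<le> c * f" using assms by (simp add: defs)
  ultimately have "1 + a * d + b * e \<le> c * f" by (rule power2_le_imp_le)
  then show ?thesis by (simp add: minkowski_def defs algebra_simps)
qed

lemma hyperbolic_geodesic:
  assumes "\<kappa> < 0" "u \<in> model_space \<kappa>" "v \<in> model_space \<kappa>" "0 \<le> c"
    "minkowski u v = cosh (sqrt (- \<kappa>) * c)"
  shows "model_dist \<kappa> u v = c \<and>
    (\<exists>\<gamma>. geodesic_between (model_space \<kappa>) (model_dist \<kappa>) \<gamma> u v \<and>
      (\<forall>s\<in>{0..c}. \<gamma> s \<in> model_space \<kappa> \<and>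
        (\<forall>w. sinh (sqrt (- \<kappa>) * c) * minkowski (\<gamma> s) w
           = sinh (sqrt (- \<kappa>) * (c - s)) * minkowski u w + sinh (sqrt (- \<kappa>) * s) * minkowski v w)))"
proof
  have md: "model_dist \<kappa> u v = arcosh (minkowski u v) / sqrt (- \<kappa>)" for u v
    using assms(1) by (simp add: model_dist_def minkowski_def)
  have ms: "u \<in> model_space \<kappa> \<longleftrightarrow> minkowski u u = 1 \<and> 0 < u$3" for u
    using assms(1) by (auto simp: model_space_def minkowski_def power2_eq_square)
  show d: "model_dist \<kappa> u v = c"
    using assms by (simp add: md arcosh_cosh_real)
  obtain \<gamma> where \<gamma>: "\<gamma> 0 = u" "\<gamma> c = v"
    "\<forall>s\<in>{0..c}. minkowski (\<gamma> s) (\<gamma> s) = 1 \<and> 0 < \<gamma> s $ 3 \<and>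
      (\<forall>t\<in>{0..c}. arcosh (minkowski (\<gamma> s) (\<gamma> t)) / sqrt (- \<kappa>) = \<bar>s - t\<bar>) \<and>
      (\<forall>w. sinh (sqrt (- \<kappa>) * c) * minkowski (\<gamma> s) w
         = sinh (sqrt (- \<kappa>) * (c - s)) * minkowski u w + sinh (sqrt (- \<kappa>) * s) * minkowski v w)"
    using hyperboloid_arc[of "sqrt (- \<kappa>)" u v c] assms unfolding ms by auto
  have "geodesic_between (model_space \<kappa>) (model_dist \<kappa>) \<gamma> u v"
    using \<gamma> unfolding geodesic_between_def d unfolding md by (auto simp: ms)
  with \<gamma>(3) show "\<exists>\<gamma>. geodesic_between (model_space \<kappa>) (model_dist \<kappa>) \<gamma> u v \<and>
      (\<forall>s\<in>{0..c}. \<gamma> s \<in> model_space \<kappa> \<and>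
        (\<forall>w. sinh (sqrt (- \<kappa>) * c) * minkowski (\<gamma> s) w
           = sinh (sqrt (- \<kappa>) * (c - s)) * minkowski u w + sinh (sqrt (- \<kappa>) * s) * minkowski v w))"
    unfolding ms by blast
qed

lemma CAT_hyperbolic_comparison:
  fixes M :: "'a::metric_space set"
  assumes "CAT \<kappa> M" "\<kappa> < 0" "x \<in> M" "y \<in> M" "z \<in> M" "geodesic_between M dist \<gamma> y z"
    and s: "s \<in> {0..dist y z}" and k_def: "k = sqrt (- \<kappa>)"
  shows "sinh (k * dist y z) * cosh (k * dist (\<gamma> s) x)
    \<le> sinh (k * (dist y z - s)) * cosh (k * dist y x) + sinh (k * s) * cosh (k * dist z x)"
proof -
  have k: "0 < k" using assms by (simp add: k_def)
  define a b c where "a = k * dist x y" "b = k * dist z x" "c = k * dist y z"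
  note abc = this
  have abc0: "0 \<le> a" "0 \<le> b" "0 \<le> c" using k by (auto simp: abc)
  have tri: "a \<le> b + c" "b \<le> a + c" "c \<le> a + b"
    unfolding abc distrib_left[symmetric] using k
    by (metis dist_commute dist_triangle add.commute mult_le_cancel_left_pos)+
  obtain t where t: "\<bar>t\<bar> \<le> 1" "cosh c * cosh a - sinh c * sinh a * t = cosh b"
    using exists_cosine_hyperbolic[of a b c] abc0 tri by auto
  have t2: "t\<^sup>2 \<le> 1" using t(1) by (simp add: abs_square_le_1)
  have ms: "u \<in> model_space \<kappa> \<longleftrightarrow> minkowski u u = 1 \<and> 0 < u$3" for u
    using assms(2) by (auto simp: model_space_def minkowski_def power2_eq_square)
  define yb zb xb :: "real^3" where "yb = vector [0, 0, 1]" "zb = vector [sinh c, 0, cosh c]"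
    "xb = vector [sinh a * t, sinh a * sqrt (1 - t\<^sup>2), cosh a]"
  note defs = this
  have n: "yb \<in> model_space \<kappa>" "zb \<in> model_space \<kappa>" "xb \<in> model_space \<kappa>"
    unfolding ms minkowski_def power2_eq_square[symmetric]
    using t2 cosh_square_eq[of a] cosh_square_eq[of c]
    by (auto simp: defs power_mult_distrib algebra_simps)
  have i: "minkowski yb zb = cosh c" "minkowski zb xb = cosh b" "minkowski xb yb = cosh a"
    using t(2) by (auto simp: defs minkowski_def algebra_simps)
  obtain \<gamma>b where \<gamma>b: "geodesic_between (model_space \<kappa>) (model_dist \<kappa>) \<gamma>b yb zb"
      "\<gamma>b s \<in> model_space \<kappa>" "sinh c * minkowski (\<gamma>b s) xb
        = sinh (k * (dist y z - s)) * minkowski yb xb + sinh (k * s) * minkowski zb xb"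
    and d1: "model_dist \<kappa> yb zb = dist y z"
    using hyperbolic_geodesic[of \<kappa> yb zb "dist y z"] n i assms(2) s unfolding abc k_def by auto
  obtain \<gamma>' where \<gamma>': "geodesic_between (model_space \<kappa>) (model_dist \<kappa>) \<gamma>' zb xb"
    and d2: "model_dist \<kappa> zb xb = dist z x"
    using hyperbolic_geodesic[of \<kappa> zb xb "dist z x"] n i assms(2) unfolding abc k_def by auto
  obtain \<gamma>'' where \<gamma>'': "geodesic_between (model_space \<kappa>) (model_dist \<kappa>) \<gamma>'' xb yb"
    and d3: "model_dist \<kappa> xb yb = dist x y"
    using hyperbolic_geodesic[of \<kappa> xb yb "dist x y"] n i assms(2) unfolding abc k_def by auto
  have "dist (\<gamma> s) x \<le> model_dist \<kappa> (\<gamma>b s) xb"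
    by (rule CAT_vertex_comparison[OF assms(1,3-6) _ n d1 d2 d3 \<gamma>b(1) \<gamma>' \<gamma>'' s])
       (use assms(2) in auto)
  then have "k * dist (\<gamma> s) x \<le> arcosh (minkowski (\<gamma>b s) xb)"
    using assms(2) by (simp add: model_dist_def k_def field_simps minkowski_def)
  moreover have I: "1 \<le> minkowski (\<gamma>b s) xb"
    using n(3) \<gamma>b(2) minkowski_ge_1 unfolding ms by blast
  ultimately have "cosh (k * dist (\<gamma> s) x) \<le> cosh (arcosh (minkowski (\<gamma>b s) xb))"
    using k by (subst cosh_real_nonneg_le_iff) (auto intro: order_trans[rotated])
  then have "cosh (k * dist (\<gamma> s) x) \<le> minkowski (\<gamma>b s) xb" using I by simp
  then have "sinh c * cosh (k * dist (\<gamma> s) x) \<le> sinh c * minkowski (\<gamma>b s) xb"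
    using abc0 by (intro mult_left_mono) auto
  then show ?thesis
    unfolding \<gamma>b(3) using i minkowski_simps(3)[of yb xb] by (simp add: abc dist_commute)
qed

text \<open>The last clause is Stewart's theorem, multiplied by \<open>c\<close> so that it also
  covers the degenerate segment.\<close>

lemma euclidean_geodesic:
  assumes "u \<in> model_space 0" "v \<in> model_space 0" "c = dist u v"
  shows "\<exists>\<gamma>. geodesic_between (model_space 0) (model_dist 0) \<gamma> u v \<and>
      (\<forall>s\<in>{0..c}. \<forall>w. c * (dist (\<gamma> s) w)\<^sup>2 = (c - s) * (dist u w)\<^sup>2 + s * (dist v w)\<^sup>2 - s * (c - s) * c)"
proof (cases "c = 0")
  case True
  with assms show ?thesis
    by (intro exI[of _ "\<lambda>_. u"]) (auto simp: geodesic_between_def model_dist_def)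
next
  case False
  then have c: "0 < c" using assms by simp
  define \<gamma> where "\<gamma> s = u + (s / c) *\<^sub>R (v - u)" for s
  have "dist (\<gamma> s) (\<gamma> t) = \<bar>s - t\<bar>" for s t
  proof -
    have "\<gamma> s - \<gamma> t = ((s - t) / c) *\<^sub>R (v - u)"
      by (simp add: \<gamma>_def algebra_simps diff_divide_distrib)
    then show ?thesis using c assms(3) by (simp add: dist_norm norm_minus_commute)
  qed
  moreover have "\<gamma> 0 = u" "\<gamma> c = v" using c by (auto simp: \<gamma>_def)
  moreover have "\<gamma> s \<in> model_space 0" for s using assms by (simp add: model_space_def \<gamma>_def)
  moreover have "c * (dist (\<gamma> s) w)\<^sup>2 = (c - s) * (dist u w)\<^sup>2 + s * (dist v w)\<^sup>2 - s * (c - s) * c" for s w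
  proof -
    define p q where "p = u - w" "q = v - u"
    note pq = this
    have q: "q \<bullet> q = c\<^sup>2" using assms(3) 
      by (simp add: pq dist_norm power2_norm_eq_inner inner_diff_left inner_diff_right inner_commute)
    have "\<gamma> s - w = p + (s / c) *\<^sub>R q" "v - w = p + q" by (simp_all add: \<gamma>_def pq)
    then show ?thesis
      using c unfolding dist_norm power2_norm_eq_inner pq(1)[symmetric]
      by (simp add: inner_add_left inner_add_right q inner_commute power2_eq_square field_simps)
  qed
  ultimately show ?thesis
    unfolding geodesic_between_def using assms(3)
    by (intro exI[of _ \<gamma>]) (auto simp: model_dist_def)
qed

lemma CAT_euclidean_comparison:
  fixes M :: "'a::metric_space set"
  assumes "CAT 0 M" "x \<in> M" "y \<in> M" "z \<in> M" "geodesic_between M dist \<gamma> y z"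
    and s: "s \<in> {0..dist y z}"
  shows "dist y z * (dist (\<gamma> s) x)\<^sup>2
    \<le> (dist y z - s) * (dist y x)\<^sup>2 + s * (dist z x)\<^sup>2 - s * (dist y z - s) * dist y z"
proof -
  define a b c where "a = dist x y" "b = dist z x" "c = dist y z"
  note abc = this
  have tri: "a \<le> b + c" "b \<le> a + c" "c \<le> a + b"
    unfolding abc by (metis dist_commute dist_triangle add.commute)+
  obtain t where t: "\<bar>t\<bar> \<le> 1" "c\<^sup>2 + a\<^sup>2 - 2 * c * a * t = b\<^sup>2"
    using exists_cosine_euclidean[of a b c] tri by (auto simp: abc)
  have t2: "t\<^sup>2 \<le> 1" using t(1) by (simp add: abs_square_le_1)
  define yb zb xb :: "real^3" where "yb = vector [0, 0, 0]" "zb = vector [c, 0, 0]"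
    "xb = vector [a * t, a * sqrt (1 - t\<^sup>2), 0]"
  note defs = this
  have n: "yb \<in> model_space 0" "zb \<in> model_space 0" "xb \<in> model_space 0"
    by (auto simp: defs model_space_def)
  have i: "dist yb zb = c" "dist zb xb = b" "dist xb yb = a"
    using t(2) t2
    by (auto simp: defs dist_norm norm_eq_sqrt_inner inner_vec_def sum_3 power2_eq_square algebra_simps abc
        intro!: real_sqrt_unique)
  obtain \<gamma>b where \<gamma>b: "geodesic_between (model_space 0) (model_dist 0) \<gamma>b yb zb"
      "c * (dist (\<gamma>b s) xb)\<^sup>2 = (c - s) * (dist yb xb)\<^sup>2 + s * (dist zb xb)\<^sup>2 - s * (c - s) * c"
    using euclidean_geodesic[OF n(1,2) i(1)[symmetric]] s abc by auto
  obtain \<gamma>' where \<gamma>': "geodesic_between (model_space 0) (model_dist 0) \<gamma>' zb xb"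
    using euclidean_geodesic[OF n(2,3) refl] by auto
  obtain \<gamma>'' where \<gamma>'': "geodesic_between (model_space 0) (model_dist 0) \<gamma>'' xb yb"
    using euclidean_geodesic[OF n(3,1) refl] by auto
  have "dist (\<gamma> s) x \<le> model_dist 0 (\<gamma>b s) xb"
    by (rule CAT_vertex_comparison[OF assms(1-5) _ n _ _ _ \<gamma>b(1) \<gamma>' \<gamma>'' s])
       (auto simp: model_dist_def i abc)
  then have "c * (dist (\<gamma> s) x)\<^sup>2 \<le> c * (dist (\<gamma>b s) xb)\<^sup>2"
    by (intro mult_left_mono power_mono) (auto simp: abc model_dist_def)
  then show ?thesis
    unfolding \<gamma>b(2) i dist_commute[of yb xb] by (simp add: abc dist_commute)
qed

section \<open>Nonpositive curvature\<close>

text \<open>\<open>sinhc (sqrt u) / 2\<close> is the derivative of \<open>cosh (sqrt u)\<close> with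
  respect to \<open>u\<close>. Its monotonicity is therefore the convexity of that function, and
  \<open>cosh_tangent_square\<close> is the tangent line inequality.\<close>

definition sinhc :: "real \<Rightarrow> real" where
  "sinhc x = (if x = 0 then 1 else sinh x / x)"

lemma sinh_le_mult_cosh: "sinh x \<le> x * cosh x" if "0 \<le> x" for x :: real
proof -
  have "0 * cosh 0 - sinh 0 \<le> x * cosh x - sinh x"
  proof (rule DERIV_nonneg_imp_nondecreasing[OF that])
    fix t :: real assume "0 \<le> t" "t \<le> x"
    have "((\<lambda>x. x * cosh x - sinh x) has_real_derivative (t * sinh t)) (at t)"
      by (auto intro!: derivative_eq_intros)
    then show "\<exists>y. ((\<lambda>x. x * cosh x - sinh x) has_real_derivative y) (at t) \<and> 0 \<le> y"
      using \<open>0 \<le> t\<close> by (intro exI[of _ "t * sinh t"]) auto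
  qed
  then show ?thesis by simp
qed

lemma sinhc_mult: "x * sinhc x = sinh x"
  by (simp add: sinhc_def)

lemma sinhc_mono: "sinhc x \<le> sinhc y" if "0 \<le> x" "x \<le> y"
proof (cases "x = 0")
  case True
  have "0 \<le> y" using that by simp
  then have "sinh 0 - 0 \<le> sinh y - y"
  proof (rule DERIV_nonneg_imp_nondecreasing)
    fix t :: real
    assume "0 \<le> t" "t \<le> y"
    show "\<exists>D. ((\<lambda>x. sinh x - x) has_real_derivative D) (at t) \<and> 0 \<le> D"
      by (rule exI[of _ "cosh t - 1"]) (auto intro!: derivative_eq_intros simp: cosh_real_ge_1)
  qed
  then have "y \<le> sinh y" by simp
  then show ?thesis using True that by (simp add: sinhc_def)
next
  case False
  have "sinh x / x \<le> sinh y / y"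
  proof (rule DERIV_nonneg_imp_nondecreasing[OF that(2)])
    fix t assume t: "x \<le> t" "t \<le> y"
    then have "0 < t" using False that by simp
    then have "((\<lambda>x. sinh x / x) has_real_derivative ((t * cosh t - sinh t) / t\<^sup>2)) (at t)"
      by (auto intro!: derivative_eq_intros simp: power2_eq_square)
    then show "\<exists>D. ((\<lambda>x. sinh x / x) has_real_derivative D) (at t) \<and> 0 \<le> D"
      using sinh_le_mult_cosh[of t] \<open>0 < t\<close> by (intro exI[of _ "(t * cosh t - sinh t) / t\<^sup>2"]) auto
  qed
  then show ?thesis using False that by (simp add: sinhc_def)
qed

lemma cosh_tangent_square:
  assumes "0 \<le> x" "0 \<le> y"
  shows "sinhc y / 2 * (x\<^sup>2 - y\<^sup>2) \<le> cosh x - cosh y"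
proof -
  define f where "f x = cosh x - sinhc y / 2 * x\<^sup>2" for x
  have der: "(f has_real_derivative t * (sinhc t - sinhc y)) (at t)" for t
    unfolding f_def by (auto intro!: derivative_eq_intros simp: algebra_simps sinhc_mult)
  have "f y \<le> f x"
  proof (cases "y \<le> x")
    case True
    show ?thesis
    proof (rule DERIV_nonneg_imp_nondecreasing[OF True])
      fix t assume "y \<le> t" "t \<le> x"
      then show "\<exists>D. (f has_real_derivative D) (at t) \<and> 0 \<le> D"
        using der[of t] sinhc_mono[of y t] assms
        by (intro exI[of _ "t * (sinhc t - sinhc y)"]) auto
    qed
  next
    case False
    show ?thesis
    proof (rule DERIV_nonpos_imp_nonincreasing[of x y])
      fix t assume "x \<le> t" "t \<le> y"
      then show "\<exists>D. (f has_real_derivative D) (at t) \<and> D \<le> 0"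
        using der[of t] sinhc_mono[of t y] assms
        by (intro exI[of _ "t * (sinhc t - sinhc y)"]) (auto intro!: mult_nonneg_nonpos)
    qed (use False in auto)
  qed
  then show ?thesis by (simp add: f_def algebra_simps)
qed

text \<open>With \<open>P = m + c / 2\<close> and \<open>Q = \<bar>m - c / 2\<bar>\<close> the hyperbolic median inequality reads
  \<open>cosh P + cosh Q \<le> cosh a + cosh b\<close>; since \<open>P\<close> dominates \<open>a\<close> and \<open>b\<close>, convexity of
  \<open>u \<mapsto> cosh (sqrt u)\<close> turns it into \<open>P\<^sup>2 + Q\<^sup>2 \<le> a\<^sup>2 + b\<^sup>2\<close>.\<close>

lemma hyperbolic_median_imp_euclidean:
  fixes a b c m :: real
  assumes "0 \<le> a" "0 \<le> b" "0 \<le> m" "0 \<le> c" "a \<le> m + c / 2" "b \<le> m + c / 2"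
    and "2 * cosh m * cosh (c / 2) \<le> cosh a + cosh b"
  shows "m\<^sup>2 + (c / 2)\<^sup>2 \<le> (a\<^sup>2 + b\<^sup>2) / 2"
  using assms
proof (induction a b rule: linorder_wlog)
  case (sym a b)
  then show ?case by (simp add: add.commute)
next
  case (le b a)
  define P Q where "P = m + c / 2" "Q = \<bar>m - c / 2\<bar>"
  note PQ = this
  have "cosh P + cosh Q \<le> cosh a + cosh b"
    using le by (simp add: PQ cosh_add cosh_diff)
  moreover have "sinhc a / 2 * (P\<^sup>2 - a\<^sup>2) \<le> cosh P - cosh a"
    using le by (intro cosh_tangent_square) (auto simp: PQ)
  moreover have "sinhc b / 2 * (Q\<^sup>2 - b\<^sup>2) \<le> cosh Q - cosh b"
    using le by (intro cosh_tangent_square) (auto simp: PQ)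
  ultimately have *: "sinhc a * (P\<^sup>2 - a\<^sup>2) \<le> sinhc b * (b\<^sup>2 - Q\<^sup>2)"
    by (simp add: algebra_simps)
  have pos: "0 < sinhc a" "0 < sinhc b" using sinhc_mono[of 0 a] sinhc_mono[of 0 b] le by (auto simp: sinhc_def)
  \<comment> \<open>Positivity on the left passes to \<open>b\<^sup>2 - Q\<^sup>2\<close>; since
    \<open>b\<close> is the smaller side, its slope \<open>sinhc b\<close> can then be raised to
    \<open>sinhc a\<close> and cancelled.\<close>
  have "0 \<le> P\<^sup>2 - a\<^sup>2" using le by (auto simp: PQ intro!: power_mono)
  then have "0 \<le> sinhc b * (b\<^sup>2 - Q\<^sup>2)" using * pos by (meson mult_nonneg_nonneg less_imp_le order_trans)
  then have "0 \<le> b\<^sup>2 - Q\<^sup>2" using pos by (simp add: zero_le_mult_iff)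
  then have "sinhc b * (b\<^sup>2 - Q\<^sup>2) \<le> sinhc a * (b\<^sup>2 - Q\<^sup>2)"
    using sinhc_mono[of b a] le by (intro mult_right_mono) auto
  with * have "sinhc a * (P\<^sup>2 - a\<^sup>2) \<le> sinhc a * (b\<^sup>2 - Q\<^sup>2)" by linarith
  then have "P\<^sup>2 - a\<^sup>2 \<le> b\<^sup>2 - Q\<^sup>2" using pos by simp
  moreover have "P\<^sup>2 + Q\<^sup>2 = 2 * (m\<^sup>2 + (c / 2)\<^sup>2)"
    by (simp add: PQ power2_eq_square algebra_simps)
  ultimately show ?case by simp
qed

section \<open>From midpoints to all points of a geodesic\<close>

text \<open>If the difference to the chord had a positive maximum, its leftmost maximiser would be
  interior; midpoint convexity around it forces a maximiser further to the left.\<close>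

lemma midpoint_convex_continuous_imp_below_chord:
  fixes \<phi> :: "real \<Rightarrow> real"
  assumes cont: "continuous_on {0..c} \<phi>"
    and mid: "\<And>s t. s \<in> {0..c} \<Longrightarrow> t \<in> {0..c} \<Longrightarrow> \<phi> ((s + t) / 2) \<le> (\<phi> s + \<phi> t) / 2"
    and x: "x \<in> {0..c}"
  shows "c * \<phi> x \<le> (c - x) * \<phi> 0 + x * \<phi> c"
proof -
  define g where "g s = c * \<phi> s - (c - s) * \<phi> 0 - s * \<phi> c" for s
  have c: "0 \<le> c" using x by auto
  have gcont: "continuous_on {0..c} g"
    unfolding g_def by (intro continuous_intros cont)
  have gmid: "g ((s + t) / 2) \<le> (g s + g t) / 2" if "s \<in> {0..c}" "t \<in> {0..c}" for s t
    using mult_left_mono[OF mid[OF that] c] by (simp add: g_def field_simps)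
  obtain m where m: "m \<in> {0..c}" "\<And>s. s \<in> {0..c} \<Longrightarrow> g s \<le> g m"
    using continuous_attains_sup[OF compact_Icc _ gcont] x by (metis empty_iff)
  have "g m \<le> 0"
  proof (rule ccontr)
    assume pos: "\<not> g m \<le> 0"
    have "compact {s \<in> {0..c}. g s = g m}"
    proof -
      have "closed {s \<in> {0..c}. g s = g m}"
        using continuous_closed_preimage_constant[OF gcont] by simp
      then show ?thesis by (auto simp: compact_eq_bounded_closed intro: bounded_subset[OF compact_imp_bounded[OF compact_Icc[of 0 c]]])
    qed
    then obtain s where s: "s \<in> {0..c}" "g s = g m" "\<And>t. t \<in> {0..c} \<Longrightarrow> g t = g m \<Longrightarrow> s \<le> t"
      using compact_attains_inf[of "{s \<in> {0..c}. g s = g m}"] m(1) by blast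
    define h where "h = min s (c - s)"
    have "s \<noteq> 0" "s \<noteq> c" using pos s(2) by (auto simp: g_def)
    then have h: "0 < h" "s - h \<in> {0..c}" "s + h \<in> {0..c}"
      using s(1) by (auto simp: h_def)
    have "2 * g s \<le> g (s - h) + g (s + h)" using gmid[OF h(2,3)] by simp
    then have "g (s - h) = g m" using m(2)[OF h(2)] m(2)[OF h(3)] s(2) by linarith
    then show False using s(3)[OF h(2)] h(1) by simp
  qed
  then have "g x \<le> 0" using m(2)[OF x] by simp
  then show ?thesis by (simp add: g_def)
qed

lemma geodesic_between_continuous:
  assumes "geodesic_between M dist \<gamma> y z"
  shows "continuous_on {0..dist y z} \<gamma>"
  unfolding continuous_on_iff
proof (intro ballI allI impI)
  fix s e :: real assume "s \<in> {0..dist y z}" "0 < e"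
  then show "\<exists>d>0. \<forall>t\<in>{0..dist y z}. dist t s < d \<longrightarrow> dist (\<gamma> t) (\<gamma> s) < e"
    using assms by (intro exI[of _ e]) (auto simp: geodesic_between_def dist_real_def)
qed

lemma geodesic_between_sub:
  assumes "geodesic_between M dist \<gamma> y z" "0 \<le> s" "s \<le> t" "t \<le> dist y z"
  shows "geodesic_between M dist (\<lambda>u. \<gamma> (s + u)) (\<gamma> s) (\<gamma> t)" "dist (\<gamma> s) (\<gamma> t) = t - s"
proof -
  have g: "\<gamma> ` {0..dist y z} \<subseteq> M"
    "\<And>s t. s \<in> {0..dist y z} \<Longrightarrow> t \<in> {0..dist y z} \<Longrightarrow> dist (\<gamma> s) (\<gamma> t) = \<bar>s - t\<bar>"
    using assms(1) by (auto simp: geodesic_between_def)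
  show d: "dist (\<gamma> s) (\<gamma> t) = t - s" using g(2)[of s t] assms by simp
  show "geodesic_between M dist (\<lambda>u. \<gamma> (s + u)) (\<gamma> s) (\<gamma> t)"
    unfolding geodesic_between_def d
  proof (intro conjI ballI)
    show "(\<lambda>u. \<gamma> (s + u)) ` {0..t - s} \<subseteq> M" using g(1) assms by auto
  qed (use assms in \<open>auto simp: g(2)\<close>)
qed

text \<open>For negative \<kappa> the Euclidean inequality is obtained at midpoints only, where the
  hyperbolic comparison takes the symmetric form of a median inequality. It then spreads along the
  geodesic by convexity.\<close>

lemma CAT_nonpos_comparison:
  fixes M :: "'a::metric_space set"
  assumes CAT: "CAT \<kappa> M" and "\<kappa> \<le> 0" and x: "x \<in> M" and yz: "y \<in> M" "z \<in> M"
    and geo: "geodesic_between M dist \<gamma> y z" and s: "s \<in> {0..dist y z}"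
  shows "dist y z * (dist (\<gamma> s) x)\<^sup>2
    \<le> (dist y z - s) * (dist y x)\<^sup>2 + s * (dist z x)\<^sup>2 - s * (dist y z - s) * dist y z"
proof (cases "\<kappa> = 0")
  case True
  then show ?thesis using CAT_euclidean_comparison assms by blast
next
  case False
  then have neg: "\<kappa> < 0" using assms by simp
  define k where "k = sqrt (- \<kappa>)"
  have k: "0 < k" using neg by (simp add: k_def)
  define c where "c = dist y z"
  \<comment> \<open>Along a Euclidean geodesic the squared distance to a point has the second
    differences of \<open>s\<^sup>2\<close>. After subtracting it, the desired inequality says
    exactly that \<open>\<phi>\<close> lies below its chord.\<close>
  define \<phi> where "\<phi> s = (dist (\<gamma> s) x)\<^sup>2 - s\<^sup>2" for s
  have ends: "\<gamma> 0 = y" "\<gamma> c = z" and gM: "\<gamma> ` {0..c} \<subseteq> M"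
    using geo by (auto simp: geodesic_between_def c_def)
  have mid: "\<phi> ((s + t) / 2) \<le> (\<phi> s + \<phi> t) / 2" if st: "s \<in> {0..c}" "t \<in> {0..c}" "s < t" for s t
  proof -
    define h where "h = (t - s) / 2"
    define \<gamma>' where "\<gamma>' = (\<lambda>u. \<gamma> (s + u))"
    note sub = geodesic_between_sub[OF geo, of s t]
    have h: "0 < h" and d: "dist (\<gamma> s) (\<gamma> t) = 2 * h" and m: "\<gamma>' h = \<gamma> ((s + t) / 2)"
      and geo': "geodesic_between M dist \<gamma>' (\<gamma> s) (\<gamma> t)"
      using sub st by (auto simp: h_def \<gamma>'_def c_def field_simps)
    have d2: "dist (\<gamma> s) (\<gamma>' h) = h" "dist (\<gamma>' h) (\<gamma> t) = h"
      using geodesic_between_sub(2)[OF geo, of s "(s + t) / 2"]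
        geodesic_between_sub(2)[OF geo, of "(s + t) / 2" t] st
      unfolding m by (auto simp: c_def h_def field_simps)
    define a b r where "a = k * dist (\<gamma> s) x" "b = k * dist (\<gamma> t) x" "r = k * dist (\<gamma>' h) x"
    note abr = this
    have "sinh (k * (2 * h)) * cosh r \<le> sinh (k * h) * (cosh a + cosh b)"
      using CAT_hyperbolic_comparison[OF CAT neg x _ _ geo' _ k_def, of h] gM st h
      by (auto simp: abr d image_subset_iff algebra_simps)
    moreover have "sinh (k * (2 * h)) = 2 * sinh (k * h) * cosh (k * h)"
      using sinh_double[of "k * h"] by (simp add: algebra_simps)
    ultimately have "sinh (k * h) * (2 * cosh r * cosh (k * h)) \<le> sinh (k * h) * (cosh a + cosh b)"
      by (simp add: algebra_simps)
    then have "2 * cosh r * cosh (k * (2 * h) / 2) \<le> cosh a + cosh b"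
      using k h by simp
    \<comment> \<open>The triangle inequality through the midpoint provides the domination of both
      sides that \<open>hyperbolic_median_imp_euclidean\<close> assumes.\<close>
    moreover have "dist (\<gamma> s) x \<le> dist (\<gamma>' h) x + h" "dist (\<gamma> t) x \<le> dist (\<gamma>' h) x + h"
      using dist_triangle[of "\<gamma> s" x "\<gamma>' h"] dist_triangle[of "\<gamma> t" x "\<gamma>' h"] d2
      by (simp_all add: dist_commute)
    then have "a \<le> r + k * (2 * h) / 2" "b \<le> r + k * (2 * h) / 2"
      using k unfolding abr by (simp_all flip: distrib_left)
    ultimately have "r\<^sup>2 + (k * (2 * h) / 2)\<^sup>2 \<le> (a\<^sup>2 + b\<^sup>2) / 2"
      using k h by (intro hyperbolic_median_imp_euclidean) (auto simp: abr)
    then have "k\<^sup>2 * ((dist (\<gamma>' h) x)\<^sup>2 + h\<^sup>2) \<le> k\<^sup>2 * (((dist (\<gamma> s) x)\<^sup>2 + (dist (\<gamma> t) x)\<^sup>2) / 2)"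
      by (simp add: abr power_mult_distrib algebra_simps)
    then have "(dist (\<gamma>' h) x)\<^sup>2 + h\<^sup>2 \<le> ((dist (\<gamma> s) x)\<^sup>2 + (dist (\<gamma> t) x)\<^sup>2) / 2"
      using k by simp
    then have "2 * (dist (\<gamma>' h) x)\<^sup>2 + 2 * h\<^sup>2 \<le> (dist (\<gamma> s) x)\<^sup>2 + (dist (\<gamma> t) x)\<^sup>2"
      by (simp add: field_simps)
    moreover have "2 * h\<^sup>2 = s\<^sup>2 + t\<^sup>2 - 2 * ((s + t) / 2)\<^sup>2"
      by (simp add: h_def power2_eq_square field_simps)
    ultimately show ?thesis unfolding \<phi>_def m by simp
  qed
  have "\<phi> ((s + t) / 2) \<le> (\<phi> s + \<phi> t) / 2" if "s \<in> {0..c}" "t \<in> {0..c}" for s t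
    using mid[of s t] mid[of t s] that by (cases s t rule: linorder_cases) (auto simp: add.commute)
  moreover have "continuous_on {0..c} \<phi>"
    unfolding \<phi>_def c_def by (intro continuous_intros geodesic_between_continuous[OF geo])
  ultimately have "c * \<phi> s \<le> (c - s) * \<phi> 0 + s * \<phi> c"
    using s by (intro midpoint_convex_continuous_imp_below_chord) (auto simp: c_def)
  then have "c * (dist (\<gamma> s) x)\<^sup>2 \<le> (c - s) * (dist y x)\<^sup>2 + s * (dist z x)\<^sup>2 - s * (c - s) * c"
    unfolding \<phi>_def ends by (simp add: algebra_simps power2_eq_square)
  then show ?thesis unfolding c_def .
qed

section \<open>Existence of minimisers\<close>

text \<open>Any minimising sequence is Cauchy: two points with nearly minimal values at distance at
  least \<open>e\<close> would admit a point whose value is below the infimum. This replaces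
  compactness.\<close>

lemma complete_minimizer_exists:
  fixes F :: "'a::metric_space \<Rightarrow> real"
  assumes "complete S" "S \<noteq> {}" and cont: "continuous_on S F" and bdd: "\<And>u. u \<in> S \<Longrightarrow> 0 \<le> F u"
    and conv: "\<And>e. 0 < e \<Longrightarrow> \<exists>\<delta>>0. \<forall>u\<in>S. \<forall>v\<in>S. e \<le> dist u v \<longrightarrow> (\<exists>m\<in>S. F m \<le> (F u + F v) / 2 - \<delta>)"
  shows "\<exists>b\<in>S. \<forall>c\<in>S. F b \<le> F c"
proof -
  define I where "I = Inf (F ` S)"
  have bb: "bdd_below (F ` S)" using bdd by (auto intro!: bdd_belowI)
  have I: "I \<le> F u" if "u \<in> S" for u using that bb by (auto simp: I_def intro: cInf_lower)
  define r :: "nat \<Rightarrow> real" where "r n = inverse (real (Suc n))" for n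
  have "\<exists>u\<in>S. F u < I + r n" for n
    using cInf_lessD[of "F ` S" "I + r n"] \<open>S \<noteq> {}\<close> by (auto simp: I_def r_def)
  then obtain u where u: "\<And>n. u n \<in> S" "\<And>n. F (u n) < I + r n" by metis
  have "Cauchy u"
  proof (rule metric_CauchyI)
    fix e :: real assume "0 < e"
    from conv[OF this] obtain \<delta> where \<delta>: "0 < \<delta>"
      "\<And>u v. u \<in> S \<Longrightarrow> v \<in> S \<Longrightarrow> e \<le> dist u v \<Longrightarrow> \<exists>m\<in>S. F m \<le> (F u + F v) / 2 - \<delta>" by metis
    obtain N where N: "r N < \<delta>" using reals_Archimedean[OF \<delta>(1)] by (auto simp: r_def)
    have "dist (u i) (u j) < e" if "N \<le> i" "N \<le> j" for i j
    proof (rule ccontr)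
      assume "\<not> dist (u i) (u j) < e"
      then obtain m where m: "m \<in> S" "F m \<le> (F (u i) + F (u j)) / 2 - \<delta>"
        using \<delta>(2)[of "u i" "u j"] u(1) by auto
      have "2 * F m \<le> F (u i) + F (u j) - 2 * \<delta>" using m(2) by (simp add: field_simps)
      moreover have "r i \<le> r N" "r j \<le> r N"
        using that by (auto simp: r_def intro!: le_imp_inverse_le)
      ultimately show False using I[OF m(1)] u(2)[of i] u(2)[of j] N by linarith
    qed
    then show "\<exists>N. \<forall>i\<ge>N. \<forall>j\<ge>N. dist (u i) (u j) < e" by blast
  qed
  then obtain l where l: "l \<in> S" "u \<longlonglongrightarrow> l" using \<open>complete S\<close> u(1) by (auto simp: complete_def)
  have "(\<lambda>n. F (u n)) \<longlonglongrightarrow> F l"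
    using continuous_on_tendsto_compose[OF cont l(2,1)] u(1) by simp
  moreover have "(\<lambda>n. I + r n) \<longlonglongrightarrow> I + 0"
    unfolding r_def by (intro tendsto_intros LIMSEQ_inverse_real_of_nat)
  ultimately have "F l \<le> I + 0"
    by (rule LIMSEQ_le) (use u(2) less_imp_le in blast)
  then show ?thesis using l(1) I by force
qed

lemma barycenter_eqI:
  assumes "b \<in> M" "\<And>c. c \<in> M \<Longrightarrow> (\<Sum>i<n. (dist (x i) b)\<^sup>2) \<le> (\<Sum>i<n. (dist (x i) c)\<^sup>2)"
    and "\<And>b'. b' \<in> M \<Longrightarrow> (\<And>c. c \<in> M \<Longrightarrow> (\<Sum>i<n. (dist (x i) b')\<^sup>2) \<le> (\<Sum>i<n. (dist (x i) c)\<^sup>2)) \<Longrightarrow> b' = b"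
    and "0 < n"
  shows "barycenter M n x = b"
proof -
  have *: "(1 / real n * p \<le> 1 / real n * q) \<longleftrightarrow> p \<le> q" for p q
    using assms(4) by (simp add: divide_le_cancel)
  show ?thesis
    unfolding barycenter_def * by (rule the_equality) (use assms in blast)+
qed

text \<open>The Bruhat--Tits (CN) inequality.\<close>

definition nonpos_curved :: "'a::metric_space set \<Rightarrow> bool" where
  "nonpos_curved M \<longleftrightarrow> (\<forall>y\<in>M. \<forall>z\<in>M. \<forall>t\<in>{0..1}. \<exists>m\<in>M. \<forall>x\<in>M.
     (dist x m)\<^sup>2 \<le> (1 - t) * (dist x y)\<^sup>2 + t * (dist x z)\<^sup>2 - t * (1 - t) * (dist y z)\<^sup>2)"

lemma CAT_imp_nonpos_curved:
  fixes M :: "'a::metric_space set"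
  assumes "CAT \<kappa> M" "\<kappa> \<le> 0"
  shows "nonpos_curved M"
  unfolding nonpos_curved_def
proof (intro ballI)
  fix y z t assume yz: "y \<in> M" "z \<in> M" and t: "t \<in> {0..(1::real)}"
  define c where "c = dist y z"
  have "geodesic_space M" using assms(1) by (simp add: CAT_def)
  then obtain \<gamma> where \<gamma>: "geodesic_between M dist \<gamma> y z"
    using yz unfolding geodesic_space_def by blast
  have tc: "t * c \<in> {0..c}" using t by (auto simp: c_def mult_left_le_one_le)
  show "\<exists>m\<in>M. \<forall>x\<in>M.
     (dist x m)\<^sup>2 \<le> (1 - t) * (dist x y)\<^sup>2 + t * (dist x z)\<^sup>2 - t * (1 - t) * (dist y z)\<^sup>2"
  proof (intro bexI ballI)
    show "\<gamma> (t * c) \<in> M" using \<gamma> tc by (auto simp: geodesic_between_def c_def)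
    fix x assume x: "x \<in> M"
    show "(dist x (\<gamma> (t * c)))\<^sup>2 \<le> (1 - t) * (dist x y)\<^sup>2 + t * (dist x z)\<^sup>2 - t * (1 - t) * (dist y z)\<^sup>2"
    proof (cases "c = 0")
      case True
      then have "y = z" "\<gamma> 0 = y" using \<gamma> by (auto simp: c_def geodesic_between_def)
      then show ?thesis using True by (simp add: algebra_simps)
    next
      case False
      have "c * (dist (\<gamma> (t * c)) x)\<^sup>2
        \<le> c * ((1 - t) * (dist y x)\<^sup>2 + t * (dist z x)\<^sup>2 - t * (1 - t) * c\<^sup>2)"
        using CAT_nonpos_comparison[OF assms x yz \<gamma>, of "t * c"] tc
        by (simp add: c_def algebra_simps power2_eq_square)
      moreover have "0 < c" using False by (simp add: c_def)
      ultimately show ?thesis by (simp add: dist_commute c_def)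
    qed
  qed
qed

text \<open>The point provided by \<open>nonpos_curved\<close> is the same for every
  \<open>x\<close>, which is what permits summation.\<close>

lemma nonpos_curved_sum:
  assumes "nonpos_curved M" "y \<in> M" "z \<in> M" "t \<in> {0..1}" "\<And>i. i < n \<Longrightarrow> x i \<in> M"
  shows "\<exists>m\<in>M. (\<Sum>i<n. (dist (x i) m)\<^sup>2)
    \<le> (1 - t) * (\<Sum>i<n. (dist (x i) y)\<^sup>2) + t * (\<Sum>i<n. (dist (x i) z)\<^sup>2) - real n * (t * (1 - t) * (dist y z)\<^sup>2)"
proof -
  obtain m where m: "m \<in> M" "\<And>x. x \<in> M \<Longrightarrow>
     (dist x m)\<^sup>2 \<le> (1 - t) * (dist x y)\<^sup>2 + t * (dist x z)\<^sup>2 - t * (1 - t) * (dist y z)\<^sup>2"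
    using assms(1-4) unfolding nonpos_curved_def by blast
  have "(\<Sum>i<n. (dist (x i) m)\<^sup>2)
    \<le> (\<Sum>i<n. (1 - t) * (dist (x i) y)\<^sup>2 + t * (dist (x i) z)\<^sup>2 - t * (1 - t) * (dist y z)\<^sup>2)"
    using m(2) assms(5) by (intro sum_mono) auto
  then show ?thesis using m(1)
    by (intro bexI[of _ m]) (simp add: sum.distrib sum_subtractf sum_distrib_left)
qed

text \<open>Moving from \<open>b\<close> by a fraction \<open>t\<close> towards \<open>z\<close>
  does not lower the sum. Division by \<open>t\<close> leaves the claim with a factor
  \<open>1 - t\<close>, which tends to 1 as \<open>t\<close> tends to 0; the midpoint alone would
  give only half the variance term.\<close>

lemma variance_inequality:
  assumes "nonpos_curved M" "b \<in> M" "z \<in> M" "\<And>i. i < n \<Longrightarrow> x i \<in> M"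
    and min: "\<And>c. c \<in> M \<Longrightarrow> (\<Sum>i<n. (dist (x i) b)\<^sup>2) \<le> (\<Sum>i<n. (dist (x i) c)\<^sup>2)"
  shows "(\<Sum>i<n. (dist (x i) b)\<^sup>2) + real n * (dist b z)\<^sup>2 \<le> (\<Sum>i<n. (dist (x i) z)\<^sup>2)"
proof -
  define A B D where "A = (\<Sum>i<n. (dist (x i) b)\<^sup>2)" "B = (\<Sum>i<n. (dist (x i) z)\<^sup>2)"
    "D = real n * (dist b z)\<^sup>2"
  note ABD = this
  have step: "A + (1 - t) * D \<le> B" if t: "0 < t" "t \<le> 1" for t
  proof -
    obtain m where "m \<in> M" "(\<Sum>i<n. (dist (x i) m)\<^sup>2) \<le> (1 - t) * A + t * B - t * (1 - t) * D"
      using nonpos_curved_sum[OF assms(1-3), of t n x] assms(4) t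
      unfolding ABD by (auto simp: algebra_simps)
    then have "A \<le> (1 - t) * A + t * B - t * (1 - t) * D" using min[of m] unfolding ABD by linarith
    then have "t * (A + (1 - t) * D) \<le> t * B" by (simp add: algebra_simps)
    then show ?thesis using t by simp
  qed
  have "((\<lambda>t. A + (1 - t) * D) \<longlongrightarrow> A + (1 - 0) * D) (at_right 0)"
    by (intro tendsto_intros)
  moreover have "\<forall>\<^sub>F t in at_right 0. A + (1 - t) * D \<le> B"
    unfolding eventually_at_right_field by (rule exI[of _ 1]) (auto intro: step)
  ultimately have "A + (1 - 0) * D \<le> B"
    by (rule tendsto_upperbound) simp
  then show ?thesis unfolding ABD by simp
qed

text \<open>Both \<open>b\<close> and \<open>d\<close> are compared with a point \<open>m\<close> of
  the diagonal from \<open>a\<close> to \<open>c\<close>, and joined through \<open>m\<close> by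
  \<open>(u + v)\<^sup>2 \<le> u\<^sup>2 / t + v\<^sup>2 / (1 - t)\<close>. Splitting the diagonal
  in the ratio of the lengths \<open>p\<close> and \<open>q\<close> makes each of the two error
  terms equal to \<open>p * q\<close>.\<close>

lemma quadrilateral_inequality:
  assumes "nonpos_curved M" "a \<in> M" "b \<in> M" "c \<in> M" "d \<in> M"
  shows "(dist a c)\<^sup>2 + (dist b d)\<^sup>2
    \<le> (dist b c)\<^sup>2 + (dist a d)\<^sup>2 + 2 * dist a b * dist c d"
proof (cases "a = b \<or> c = d")
  case True
  then show ?thesis by auto
next
  case False
  define p q where "p = dist a b" "q = dist c d"
  note pq = this
  have p: "0 < p" and q: "0 < q" using False by (auto simp: pq)
  define t where "t = p / (p + q)"
  have t: "0 < t" "t < 1" using p q by (auto simp: t_def)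
  then obtain m where m: "m \<in> M" "\<And>x. x \<in> M \<Longrightarrow>
     (dist x m)\<^sup>2 \<le> (1 - t) * (dist x a)\<^sup>2 + t * (dist x c)\<^sup>2 - t * (1 - t) * (dist a c)\<^sup>2"
    using assms unfolding nonpos_curved_def by (metis atLeastAtMost_iff less_imp_le)
  define u v where "u = dist b m" "v = dist d m"
  note uv = this
  have "(dist b d)\<^sup>2 \<le> (u + v)\<^sup>2"
    using dist_triangle2[of b d m] by (intro power_mono) (auto simp: uv)
  also have "(u + v)\<^sup>2 \<le> u\<^sup>2 / t + v\<^sup>2 / (1 - t)"
  proof -
    have "0 \<le> ((1 - t) * u - t * v)\<^sup>2 / (t * (1 - t))" using t by simp
    also have "\<dots> = u\<^sup>2 / t + v\<^sup>2 / (1 - t) - (u + v)\<^sup>2"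
      using t by (simp add: field_simps power2_eq_square)
    finally show ?thesis by simp
  qed
  also have "\<dots> \<le> ((1 - t) * p\<^sup>2 + t * (dist b c)\<^sup>2 - t * (1 - t) * (dist a c)\<^sup>2) / t
      + ((1 - t) * (dist a d)\<^sup>2 + t * q\<^sup>2 - t * (1 - t) * (dist a c)\<^sup>2) / (1 - t)"
    using m(2)[OF assms(3)] m(2)[OF assms(5)] t
    by (intro add_mono divide_right_mono) (auto simp: uv pq dist_commute)
  also have "\<dots> = (1 - t) / t * p\<^sup>2 + t / (1 - t) * q\<^sup>2 + (dist b c)\<^sup>2 + (dist a d)\<^sup>2 - (dist a c)\<^sup>2"
    using t by (simp add: field_simps)
  also have "1 - t = q / (p + q)" using p q by (simp add: t_def field_simps)
  also have "q / (p + q) / t * p\<^sup>2 = p * q" using p q by (simp add: t_def power2_eq_square)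
  also have "t / (q / (p + q)) * q\<^sup>2 = p * q" using p q by (simp add: t_def power2_eq_square)
  finally show ?thesis by (simp add: pq)
qed

lemma barycenter_nonpos_curved:
  fixes M :: "'a::metric_space set"
  assumes "nonpos_curved M" "complete M" "0 < n" and x: "\<And>i. i < n \<Longrightarrow> x i \<in> M"
  shows "barycenter M n x \<in> M"
    "\<And>c. c \<in> M \<Longrightarrow> (\<Sum>i<n. (dist (x i) (barycenter M n x))\<^sup>2) \<le> (\<Sum>i<n. (dist (x i) c)\<^sup>2)"
proof -
  have "\<exists>b\<in>M. \<forall>c\<in>M. (\<Sum>i<n. (dist (x i) b)\<^sup>2) \<le> (\<Sum>i<n. (dist (x i) c)\<^sup>2)"
  proof (rule complete_minimizer_exists[OF assms(2)])
    show "M \<noteq> {}" using x[of 0] assms(3) by auto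
    show "continuous_on M (\<lambda>b. \<Sum>i<n. (dist (x i) b)\<^sup>2)" by (intro continuous_intros)
    show "0 \<le> (\<Sum>i<n. (dist (x i) b)\<^sup>2)" for b by (intro sum_nonneg) auto
    fix e :: real assume e: "0 < e"
    show "\<exists>\<delta>>0. \<forall>u\<in>M. \<forall>v\<in>M. e \<le> dist u v \<longrightarrow> (\<exists>m\<in>M. (\<Sum>i<n. (dist (x i) m)\<^sup>2)
        \<le> ((\<Sum>i<n. (dist (x i) u)\<^sup>2) + (\<Sum>i<n. (dist (x i) v)\<^sup>2)) / 2 - \<delta>)"
    proof (intro exI[of _ "real n * (e\<^sup>2 / 4)"] conjI ballI impI)
      show "0 < real n * (e\<^sup>2 / 4)" using e assms(3) by simp
      fix u v assume uv: "u \<in> M" "v \<in> M" "e \<le> dist u v"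
      have "real n * (e\<^sup>2 / 4) \<le> real n * ((dist u v)\<^sup>2 / 4)"
        using uv(3) e by (intro mult_left_mono divide_right_mono power_mono) auto
      with nonpos_curved_sum[OF assms(1) uv(1,2), of "1 / 2" n x] x
      show "\<exists>m\<in>M. (\<Sum>i<n. (dist (x i) m)\<^sup>2)
        \<le> ((\<Sum>i<n. (dist (x i) u)\<^sup>2) + (\<Sum>i<n. (dist (x i) v)\<^sup>2)) / 2 - real n * (e\<^sup>2 / 4)"
        by (auto simp: add_divide_distrib elim!: bexI[rotated])
    qed
  qed
  then obtain b where b: "b \<in> M" "\<And>c. c \<in> M \<Longrightarrow> (\<Sum>i<n. (dist (x i) b)\<^sup>2) \<le> (\<Sum>i<n. (dist (x i) c)\<^sup>2)"
    by blast
  have "barycenter M n x = b"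
  proof (rule barycenter_eqI[OF b _ assms(3)])
    fix b' assume b': "b' \<in> M" "\<And>c. c \<in> M \<Longrightarrow> (\<Sum>i<n. (dist (x i) b')\<^sup>2) \<le> (\<Sum>i<n. (dist (x i) c)\<^sup>2)"
    have "real n * (dist b b')\<^sup>2 \<le> 0"
      using variance_inequality[where x = x, OF assms(1) b(1) b'(1) x b(2)] b'(2)[OF b(1)] by linarith
    then have "(dist b b')\<^sup>2 \<le> 0" using assms(3) by (simp add: mult_le_0_iff)
    then show "b' = b" by simp
  qed
  then show "barycenter M n x \<in> M"
    "\<And>c. c \<in> M \<Longrightarrow> (\<Sum>i<n. (dist (x i) (barycenter M n x))\<^sup>2) \<le> (\<Sum>i<n. (dist (x i) c)\<^sup>2)"
    using b by auto
qed

lemma barycenter_lipschitz_nonpos_curved: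
  fixes M :: "'a::metric_space set"
  assumes "nonpos_curved M" "complete M" "0 < n"
    and x: "\<And>i. i < n \<Longrightarrow> x i \<in> M" and y: "\<And>i. i < n \<Longrightarrow> y i \<in> M"
  shows "real n * dist (barycenter M n x) (barycenter M n y) \<le> (\<Sum>i<n. dist (x i) (y i))"
proof -
  define b b' where "b = barycenter M n x" "b' = barycenter M n y"
  note bb = this
  note b = barycenter_nonpos_curved[where x = x, OF assms(1-3) x, folded bb]
  note b' = barycenter_nonpos_curved[where x = y, OF assms(1-3) y, folded bb]
  define D where "D = dist b b'"
  have "2 * (real n * D\<^sup>2) \<le> (\<Sum>i<n. (dist (x i) b')\<^sup>2 + (dist (y i) b)\<^sup>2 - (dist (x i) b)\<^sup>2 - (dist (y i) b')\<^sup>2)"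
    using variance_inequality[where x = x, OF assms(1) b(1) b'(1) x b(2)]
      variance_inequality[where x = y, OF assms(1) b'(1) b(1) y b'(2)]
    by (simp add: D_def dist_commute sum.distrib sum_subtractf)
  also have "\<dots> \<le> (\<Sum>i<n. 2 * (dist (x i) (y i) * D))"
  proof (rule sum_mono)
    fix i assume "i \<in> {..<n}"
    then show "(dist (x i) b')\<^sup>2 + (dist (y i) b)\<^sup>2 - (dist (x i) b)\<^sup>2 - (dist (y i) b')\<^sup>2 \<le> 2 * (dist (x i) (y i) * D)"
      using quadrilateral_inequality[OF assms(1) x y b'(1) b(1), of i i] by (simp add: D_def dist_commute)
  qed
  also have "\<dots> = 2 * ((\<Sum>i<n. dist (x i) (y i)) * D)"
    by (simp add: sum_distrib_left sum_distrib_right)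
  finally have "(real n * D) * D \<le> (\<Sum>i<n. dist (x i) (y i)) * D" by (simp add: power2_eq_square)
  then show ?thesis
    unfolding bb[symmetric] D_def[symmetric]
    by (cases "D = 0") (auto simp: D_def sum_nonneg)
qed

section \<open>Positive curvature\<close>

text \<open>\<open>D\<close> is the distance rescaled to curvature 1. The segment is parametrised by
  arc length of \<open>D\<close>, and a single \<open>g\<close> serves all test points
  \<open>x\<close> and all convex sets, so comparison inequalities along it can be added up.\<close>

locale cat_spherical =
  fixes M :: "'a::metric_space set" and k :: real and D :: "'a \<Rightarrow> 'a \<Rightarrow> real"
  assumes k_pos: "0 < k" and D_def: "D x y = k * dist x y" and complete_M: "complete M"
    and segment: "y \<in> M \<Longrightarrow> z \<in> M \<Longrightarrow> \<exists>g. \<forall>s\<in>{0..D y z}. g s \<in> M \<and> D y (g s) = s \<and>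
      (\<forall>C. geodesically_convex M C \<longrightarrow> y \<in> C \<longrightarrow> z \<in> C \<longrightarrow> g s \<in> C) \<and>
      (\<forall>x\<in>M. D x y + D y z + D z x < 2 * pi \<longrightarrow>
        sin (D y z - s) * cos (D x y) + sin s * cos (D x z) \<le> sin (D y z) * cos (D x (g s)))"
begin

lemma D_nonneg [simp]: "0 \<le> D x y"
  using k_pos by (simp add: D_def)

lemma D_commute: "D x y = D y x"
  by (simp add: D_def dist_commute)

lemma D_triangle: "D x z \<le> D x y + D y z"
  using k_pos dist_triangle[of x z y] by (simp add: D_def flip: distrib_left)

lemma D_eq_0_iff [simp]: "D x y = 0 \<longleftrightarrow> x = y"
  using k_pos by (simp add: D_def)

lemma D_self [simp]: "D x x = 0"
  by (simp add: D_def)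

lemma D_pos_iff [simp]: "0 < D x y \<longleftrightarrow> x \<noteq> y"
  using k_pos by (simp add: D_def zero_less_mult_iff)

section \<open>First variation and spherical quadrilaterals\<close>

text \<open>Each squared distance along the segment from \<open>b\<close> to \<open>z\<close> is
  replaced by a differentiable majorant with the same value at \<open>b\<close>. If the claim
  failed, the sum of the majorants would start to decrease, against minimality. Allowing any convex
  \<open>C\<close> lets the lemma serve both for projections onto a convex set and for minimisers
  over \<open>M\<close>.\<close>

lemma first_variation:
  fixes n :: nat
  assumes C: "geodesically_convex M C" "C \<subseteq> M" "b \<in> C" "z \<in> C" and x: "\<And>i. i < n \<Longrightarrow> x i \<in> M"
    and small: "D b z < pi / 2" "\<And>i. i < n \<Longrightarrow> D (x i) b < pi / 2" "\<And>i. i < n \<Longrightarrow> D (x i) z < pi / 2"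
    and min: "\<And>m. m \<in> C \<Longrightarrow> (\<Sum>i<n. (D (x i) b)\<^sup>2) \<le> (\<Sum>i<n. (D (x i) m)\<^sup>2)"
  shows "(\<Sum>i<n. wt (D (x i) b) * cos (D (x i) z)) \<le> cos (D b z) * (\<Sum>i<n. wt (D (x i) b) * cos (D (x i) b))"
proof (cases "D b z = 0")
  case True
  then show ?thesis by (simp add: sum_distrib_left)
next
  case False
  define c where "c = D b z"
  have c: "0 < c" "c < pi / 2" using False small(1) by (simp_all add: c_def)
  have sc: "0 < sin c" using c by (intro sin_gt_zero) auto
  obtain g where g: "\<And>s. s \<in> {0..c} \<Longrightarrow> g s \<in> C" "\<And>s. s \<in> {0..c} \<Longrightarrow> D b (g s) = s"
    "\<And>s x. s \<in> {0..c} \<Longrightarrow> x \<in> M \<Longrightarrow> D x b + D b z + D z x < 2 * pi \<Longrightarrow>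
        sin (c - s) * cos (D x b) + sin s * cos (D x z) \<le> sin c * cos (D x (g s))"
    using segment[of b z] C unfolding c_def by blast
  define r a where "r i = D (x i) b" and "a i = D (x i) z" for i
  \<comment> \<open>The cosine of the distance from the comparison vertex of \<open>x i\<close> to
    the point at time \<open>s\<close> of the comparison side.\<close>
  define G where "G i s = (sin (c - s) * cos (r i) + sin s * cos (a i)) / sin c" for i s
  \<comment> \<open>For \<open>x i = b\<close> the arccosine is not differentiable at its value
    \<open>1\<close>, but then the distance to the moving point is exactly \<open>s\<close>.\<close>
  define H where "H i s = (if r i = 0 then s\<^sup>2 else (arccos (G i s))\<^sup>2)" for i s
  define E where "E i = wt (r i) * (cos (a i) - cos c * cos (r i))" for i
  have der: "(H i has_real_derivative - 2 / sin c * E i) (at 0)" if i: "i < n" for i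
  proof (cases "r i = 0")
    case True
    then have "x i = b" by (simp add: r_def)
    then have "E i = 0" using True by (simp add: E_def a_def c_def)
    moreover have "H i = (\<lambda>s. s\<^sup>2)" using True by (auto simp: H_def)
    ultimately show ?thesis by (auto intro!: derivative_eq_intros)
  next
    case False
    have r: "0 < r i" "r i < pi / 2" using False small(2)[OF i] by (simp_all add: r_def)
    have G0: "G i 0 = cos (r i)" using sc by (simp add: G_def)
    have "0 < cos (r i)" "cos (r i) < 1"
      using r cos_monotone_0_pi[of 0 "r i"] by (auto intro!: cos_gt_zero)
    then have G01: "-1 < G i 0" "G i 0 < 1" by (simp_all add: G0)
    have sr: "0 < sin (r i)" using r by (intro sin_gt_zero) auto
    have "sqrt (1 - (cos (r i))\<^sup>2) = sin (r i)" using sr by (simp flip: sin_squared_eq)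
    moreover have "arccos (cos (r i)) = r i" using r by (intro arccos_cos) auto
    moreover have "(G i has_real_derivative (cos (a i) - cos c * cos (r i)) / sin c) (at 0)"
      unfolding G_def using sc by (auto intro!: derivative_eq_intros)
    then have "((\<lambda>s. (arccos (G i s))\<^sup>2) has_real_derivative
        2 * arccos (G i 0) * (inverse (- sqrt (1 - (G i 0)\<^sup>2)) * ((cos (a i) - cos c * cos (r i)) / sin c))) (at 0)"
      using G01 by (auto intro!: derivative_eq_intros DERIV_chain2[where f = arccos] DERIV_arccos)
    moreover have "H i = (\<lambda>s. (arccos (G i s))\<^sup>2)" using False by (auto simp: H_def)
    ultimately show ?thesis
      using sr r by (simp add: G0 E_def wt_def field_simps)
  qed
  have "(\<Sum>i<n. E i) \<le> 0"
  proof (rule ccontr)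
    assume "\<not> (\<Sum>i<n. E i) \<le> 0"
    then have neg: "- 2 / sin c * (\<Sum>i<n. E i) < 0"
      using sc by (simp add: mult_neg_pos divide_neg_pos)
    have "((\<lambda>s. \<Sum>i<n. H i s) has_real_derivative (\<Sum>i<n. - 2 / sin c * E i)) (at 0)"
      by (intro DERIV_sum der) auto
    then have "((\<lambda>s. \<Sum>i<n. H i s) has_real_derivative - 2 / sin c * (\<Sum>i<n. E i)) (at 0)"
      by (simp add: sum_distrib_left)
    from DERIV_neg_dec_right[OF this neg]
    obtain \<delta> where \<delta>: "0 < \<delta>" "\<And>h. 0 < h \<Longrightarrow> h < \<delta> \<Longrightarrow> (\<Sum>i<n. H i h) < (\<Sum>i<n. H i 0)"
      by auto
    define h where "h = min (\<delta> / 2) c"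
    have h: "0 < h" "h < \<delta>" "h \<in> {0..c}" using \<delta>(1) c by (auto simp: h_def)
    have "D (x i) (g h) ^ 2 \<le> H i h" if i: "i < n" for i
    proof (cases "r i = 0")
      case True
      then have "x i = b" by (simp add: r_def)
      then show ?thesis using True g(2)[OF h(3)] by (simp add: H_def)
    next
      case False
      have ca: "0 \<le> cos (a i)" "0 \<le> cos (r i)" using small(2,3)[OF i] by (auto simp: a_def r_def intro!: cos_ge_zero order_trans[OF _ D_nonneg])
      have per: "D (x i) b + D b z + D z (x i) < 2 * pi"
        using small(2,3)[OF i] small(1) pi_gt_zero unfolding D_commute[of z "x i"] by linarith
      have "sin (c - h) * cos (r i) + sin h * cos (a i) \<le> sin c * cos (D (x i) (g h))"
        using g(3)[OF h(3) x[OF i] per] by (simp add: r_def a_def)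
      then have le: "G i h \<le> cos (D (x i) (g h))" using sc by (simp add: G_def field_simps)
      \<comment> \<open>Keeps \<open>G i h\<close> inside the domain of the arccosine; the distances
        below pi / 2 are what makes all the terms nonnegative.\<close>
      have G: "0 \<le> G i h" using ca sc h c unfolding G_def
        by (intro divide_nonneg_pos add_nonneg_nonneg mult_nonneg_nonneg sin_ge_zero) auto
      have "D (x i) (g h) \<le> D (x i) b + h" using D_triangle[of "x i" "g h" b] g(2)[OF h(3)] by simp
      then have "D (x i) (g h) \<le> pi" using small(2)[OF i] h(3) c by auto
      then have "D (x i) (g h) = arccos (cos (D (x i) (g h)))" by (intro arccos_cos[symmetric]) auto
      also have "\<dots> \<le> arccos (G i h)" using le G by (intro arccos_le_arccos) auto
      finally show ?thesis using False by (simp add: H_def power_mono)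
    qed
    then have "(\<Sum>i<n. (D (x i) (g h))\<^sup>2) \<le> (\<Sum>i<n. H i h)" by (intro sum_mono) auto
    also have "\<dots> < (\<Sum>i<n. H i 0)" using \<delta>(2)[OF h(1,2)] .
    also have "\<dots> = (\<Sum>i<n. (D (x i) b)\<^sup>2)"
    proof (rule sum.cong)
      fix i assume "i \<in> {..<n}"
      then have "r i < pi / 2" using small(2)[of i] by (simp add: r_def)
      then have "r i \<le> pi" using pi_gt_zero by linarith
      moreover have "0 \<le> r i" by (simp add: r_def)
      ultimately show "H i 0 = (D (x i) b)\<^sup>2" using sc by (simp add: H_def G_def arccos_cos r_def)
    qed simp
    finally show False using min[OF g(1)[OF h(3)]] by simp
  qed
  then show ?thesis
    by (simp add: E_def a_def r_def c_def sum_subtractf right_diff_distrib sum_distrib_left mult_ac)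
qed

text \<open>In the sphere, \<open>m\<close> is the direction of the vector
  \<open>\<mu> * A + C\<close> and \<open>N\<close> is its norm. In general \<open>m\<close> is the
  point of the segment where \<open>sin (l - s) = \<mu> * sin s\<close>, found by the intermediate
  value theorem; the inner product identity becomes an inequality.\<close>

lemma weighted_point:
  assumes "A \<in> M" "C \<in> M" "D A C < pi / 2" "0 < \<mu>"
  shows "\<exists>m N. m \<in> M \<and> 0 < N \<and> N\<^sup>2 = \<mu>\<^sup>2 + 1 + 2 * \<mu> * cos (D A C) \<and> D A m \<le> D A C \<and>
    (\<forall>x\<in>M. D x A < pi / 2 \<longrightarrow> D x C < pi / 2 \<longrightarrow> \<mu> * cos (D x A) + cos (D x C) \<le> N * cos (D x m))"
proof (cases "D A C = 0")
  case True
  then show ?thesis using assms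
    by (intro exI[of _ A] exI[of _ "\<mu> + 1"]) (auto simp: power2_eq_square algebra_simps)
next
  case False
  define l where "l = D A C"
  have l: "0 < l" "l < pi / 2" using False assms(3) by (simp_all add: l_def)
  have sl: "0 < sin l" using l by (intro sin_gt_zero) auto
  obtain g where g: "\<And>s. s \<in> {0..l} \<Longrightarrow> g s \<in> M" "\<And>s. s \<in> {0..l} \<Longrightarrow> D A (g s) = s"
    "\<And>s x. s \<in> {0..l} \<Longrightarrow> x \<in> M \<Longrightarrow> D x A + D A C + D C x < 2 * pi \<Longrightarrow>
        sin (l - s) * cos (D x A) + sin s * cos (D x C) \<le> sin l * cos (D x (g s))"
    using segment[of A C] assms(1,2) unfolding l_def by blast
  have "\<exists>s. 0 \<le> s \<and> s \<le> l \<and> \<mu> * sin s - sin (l - s) = 0"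
    using l sl assms(4) by (intro IVT') (auto intro!: continuous_intros)
  then obtain s where s: "0 \<le> s" "s \<le> l" "sin (l - s) = \<mu> * sin s" by auto
  have "s \<noteq> 0" using s(3) sl by auto
  then have ss: "0 < sin s" using s l by (intro sin_gt_zero) auto
  define N where "N = sin l / sin s"
  have "(sin l)\<^sup>2 = (sin s)\<^sup>2 * (\<mu>\<^sup>2 + 1 + 2 * \<mu> * cos l)"
    using sin_arc_identity[of l s s] unfolding s(3) by (simp add: power2_eq_square algebra_simps)
  then have N2: "N\<^sup>2 = \<mu>\<^sup>2 + 1 + 2 * \<mu> * cos l" using ss by (simp add: N_def power_divide)
  have "\<mu> * cos (D x A) + cos (D x C) \<le> N * cos (D x (g s))"
    if x: "x \<in> M" "D x A < pi / 2" "D x C < pi / 2" for x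
  proof -
    have "sin s * (\<mu> * cos (D x A) + cos (D x C)) \<le> sin l * cos (D x (g s))"
      using g(3)[of s x] x s l by (simp add: l_def D_commute[of C] algebra_simps)
    then show ?thesis using ss by (simp add: N_def field_simps)
  qed
  moreover have "0 < N" using sl ss by (simp add: N_def)
  ultimately show ?thesis
    using g(1,2)[of s] s N2 unfolding l_def[symmetric] by (intro exI[of _ "g s"] exI[of _ N]) auto
qed

text \<open>In the sphere the left-hand side is \<open>(a - b) \<bullet> (d - c)\<close> for unit vectors. In general, take \<open>m\<close> on
  the diagonal from \<open>a\<close> to \<open>c\<close> in the direction of \<open>\<mu> a + c\<close>, where \<open>\<mu>\<close> is the ratio of the chord lengths
  of \<open>c d\<close> and \<open>a b\<close>, and compare with \<open>\<mu> b + d\<close>.\<close>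

lemma spherical_quadrilateral:
  assumes M: "a \<in> M" "b \<in> M" "c \<in> M" "d \<in> M"
    and small: "D a b < pi / 2" "D a c < pi / 2" "D a d < pi / 2" "D b c < pi / 2" "D b d < pi / 2" "D c d < pi / 2"
  shows "cos (D b c) + cos (D a d) - cos (D a c) - cos (D b d) \<le> 4 * sin (D a b / 2) * sin (D c d / 2)"
proof (cases "a = b \<or> c = d")
  case True
  then show ?thesis by auto
next
  case False
  define e f where "e = sin (D a b / 2)" "f = sin (D c d / 2)"
  note ef = this
  have pos: "0 < D a b" "0 < D c d" using False by simp_all
  have "D a b / 2 < pi" "D c d / 2 < pi" using small pi_gt_zero by linarith+
  then have e: "0 < e" and f: "0 < f" using pos by (auto simp: ef intro!: sin_gt_zero)
  have ab: "cos (D a b) = 1 - 2 * e\<^sup>2" "cos (D c d) = 1 - 2 * f\<^sup>2"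
    using cos_double_sin[of "D a b / 2"] cos_double_sin[of "D c d / 2"] by (simp_all add: ef)
  define \<mu> where "\<mu> = f / e"
  have \<mu>: "0 < \<mu>" using e f by (simp add: \<mu>_def)
  obtain m N where m: "m \<in> M" "0 < N" "N\<^sup>2 = \<mu>\<^sup>2 + 1 + 2 * \<mu> * cos (D a c)" "D a m \<le> D a c"
    "\<And>x. x \<in> M \<Longrightarrow> D x a < pi / 2 \<Longrightarrow> D x c < pi / 2 \<Longrightarrow> \<mu> * cos (D x a) + cos (D x c) \<le> N * cos (D x m)"
    using weighted_point[OF M(1,3) small(2) \<mu>] by blast
  define \<alpha> \<beta> where "\<alpha> = D b m" "\<beta> = D d m"
  note \<alpha>\<beta> = this
  have pc: "0 < cos (D a b)" "0 < cos (D a d)" "0 < cos (D b c)" "0 < cos (D c d)"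
    using small by (auto intro!: cos_gt_zero_pi less_le_trans[OF _ D_nonneg])
  have b1: "\<mu> * cos (D a b) + cos (D b c) \<le> N * cos \<alpha>"
    using m(5)[OF M(2)] small by (simp add: \<alpha>\<beta> D_commute[of b a])
  have d1: "\<mu> * cos (D a d) + cos (D c d) \<le> N * cos \<beta>"
    using m(5)[OF M(4)] small by (simp add: \<alpha>\<beta> D_commute[of d])
  have "0 < N * cos \<alpha>" "0 < N * cos \<beta>"
    using b1 d1 pc \<mu> by (smt (verit) mult_pos_pos)+
  then have cos_pos: "0 < cos \<alpha>" "0 < cos \<beta>" using m(2) by (simp_all add: zero_less_mult_iff)
  have "\<alpha> < pi" "\<beta> < pi"
    using D_triangle[of b m a] D_triangle[of d m a] m(4) small unfolding \<alpha>\<beta> D_commute[of b a] D_commute[of d a]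
    by linarith+
  then have half: "\<alpha> < pi / 2" "\<beta> < pi / 2"
    using cos_pos cos_monotone_0_pi_le[of "pi / 2" \<alpha>] cos_monotone_0_pi_le[of "pi / 2" \<beta>] by force+
  \<comment> \<open>The path from \<open>b\<close> to \<open>d\<close> through \<open>m\<close>
    stands in for the missing inner product structure.\<close>
  have "cos (\<alpha> + \<beta>) \<le> cos (D b d)"
    using D_triangle[of b d m] half by (intro cos_monotone_0_pi_le) (auto simp: \<alpha>\<beta> D_commute[of m d])
  then have "2 * \<mu> * cos (\<alpha> + \<beta>) \<le> 2 * \<mu> * cos (D b d)" using \<mu> by simp
  moreover have "(\<mu> * cos \<alpha> + cos \<beta>)\<^sup>2 + (\<mu> * sin \<alpha> - sin \<beta>)\<^sup>2
      = \<mu>\<^sup>2 * ((sin \<alpha>)\<^sup>2 + (cos \<alpha>)\<^sup>2) + ((sin \<beta>)\<^sup>2 + (cos \<beta>)\<^sup>2) + 2 * \<mu> * cos (\<alpha> + \<beta>)"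
    unfolding cos_add by algebra
  then have "(\<mu> * cos \<alpha> + cos \<beta>)\<^sup>2 + (\<mu> * sin \<alpha> - sin \<beta>)\<^sup>2 = \<mu>\<^sup>2 + 1 + 2 * \<mu> * cos (\<alpha> + \<beta>)"
    by simp
  \<comment> \<open>In the sphere the right side is the squared norm of \<open>\<mu> * b + d\<close>
    and the left side the square of its component along \<open>m\<close>.\<close>
  ultimately have Z: "(\<mu> * cos \<alpha> + cos \<beta>)\<^sup>2 \<le> \<mu>\<^sup>2 + 1 + 2 * \<mu> * cos (D b d)"
    using zero_le_power2[of "\<mu> * sin \<alpha> - sin \<beta>"] by linarith
  have "\<mu> * (\<mu> * cos (D a b) + cos (D b c)) + (\<mu> * cos (D a d) + cos (D c d)) \<le> \<mu> * (N * cos \<alpha>) + N * cos \<beta>"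
    using b1 d1 \<mu> by (intro add_mono mult_left_mono) auto
  also have "\<dots> = N * (\<mu> * cos \<alpha> + cos \<beta>)" by (simp add: algebra_simps)
  finally have "2 * (\<mu> * (\<mu> * cos (D a b) + cos (D b c)) + (\<mu> * cos (D a d) + cos (D c d)))
      \<le> 2 * (N * (\<mu> * cos \<alpha> + cos \<beta>))" by (rule mult_left_mono) simp
  also have "\<dots> \<le> N\<^sup>2 + (\<mu> * cos \<alpha> + cos \<beta>)\<^sup>2"
    using sum_squares_bound[of N "\<mu> * cos \<alpha> + cos \<beta>"] by (simp only: mult.assoc)
  also have "\<dots> \<le> 2 * (\<mu>\<^sup>2 + 1 + \<mu> * (cos (D a c) + cos (D b d)))"
    using Z unfolding m(3) by (simp add: algebra_simps)
  finally have "\<mu> * (cos (D b c) + cos (D a d) - cos (D a c) - cos (D b d)) \<le> 2 * (\<mu>\<^sup>2 * e\<^sup>2 + f\<^sup>2)"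
    unfolding ab by (simp add: algebra_simps power2_eq_square)
  \<comment> \<open>This ratio makes the two terms equal, which is the choice minimising
    \<open>\<mu> * e\<^sup>2 + f\<^sup>2 / \<mu>\<close>.\<close>
  also have "\<mu>\<^sup>2 * e\<^sup>2 = f\<^sup>2" using e by (simp add: \<mu>_def power_divide)
  also have "2 * (f\<^sup>2 + f\<^sup>2) = \<mu> * (4 * e * f)" using e by (simp add: \<mu>_def power2_eq_square)
  finally show ?thesis using \<mu> by (simp add: ef)
qed

text \<open>Comparison at the midpoint gives
  \<open>cos a + cos b \<le> 2 * cos (c / 2) * cos r\<close>, and \<open>square_tangent_cos\<close>
  translates cosines into squared distances. The gain degenerates as \<open>\<Delta>\<close> tends
  to pi / 2, which does no harm where only existence of minimisers is at stake.\<close>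

lemma midpoint_uniform_convexity:
  assumes "u \<in> M" "v \<in> M" "D u v < pi / 2"
  shows "\<exists>m\<in>M. (\<forall>C. geodesically_convex M C \<longrightarrow> u \<in> C \<longrightarrow> v \<in> C \<longrightarrow> m \<in> C) \<and>
    (\<forall>x\<in>M. \<forall>\<Delta>. D x u \<le> \<Delta> \<longrightarrow> D x v \<le> \<Delta> \<longrightarrow> \<Delta> < pi / 2 \<longrightarrow> D x m \<le> \<Delta> \<and>
      (D x m)\<^sup>2 \<le> ((D x u)\<^sup>2 + (D x v)\<^sup>2) / 2 - 2 * cos \<Delta> * (1 - cos (D u v / 2)))"
proof -
  define c where "c = D u v"
  have c: "0 \<le> c" "c < pi / 2" using assms by (auto simp: c_def)
  obtain g where g: "\<And>s. s \<in> {0..c} \<Longrightarrow> g s \<in> M" "\<And>s. s \<in> {0..c} \<Longrightarrow> D u (g s) = s"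
    "\<And>s C. s \<in> {0..c} \<Longrightarrow> geodesically_convex M C \<Longrightarrow> u \<in> C \<Longrightarrow> v \<in> C \<Longrightarrow> g s \<in> C"
    "\<And>s x. s \<in> {0..c} \<Longrightarrow> x \<in> M \<Longrightarrow> D x u + D u v + D v x < 2 * pi \<Longrightarrow>
        sin (c - s) * cos (D x u) + sin s * cos (D x v) \<le> sin c * cos (D x (g s))"
    using segment[of u v] assms(1,2) unfolding c_def by blast
  define m where "m = g (c / 2)"
  have c2: "c / 2 \<in> {0..c}" using c by auto
  have um: "D u m = c / 2" using g(2)[OF c2] by (simp add: m_def)
  have "D x m \<le> \<Delta> \<and> (D x m)\<^sup>2 \<le> ((D x u)\<^sup>2 + (D x v)\<^sup>2) / 2 - 2 * cos \<Delta> * (1 - cos (D u v / 2))"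
    if x: "x \<in> M" "D x u \<le> \<Delta>" "D x v \<le> \<Delta>" "\<Delta> < pi / 2" for x \<Delta>
  proof -
    define a b r where "a = D x u" "b = D x v" "r = D x m"
    note abr = this
    have main: "cos a + cos b \<le> 2 * cos (c / 2) * cos r"
    proof (cases "c = 0")
      case True
      then show ?thesis using um by (simp add: abr c_def)
    next
      case False
      then have s: "0 < sin (c / 2)" using c by (intro sin_gt_zero) auto
      have per: "D x u + D u v + D v x < 2 * pi"
        using x(2-4) c(2) pi_gt_zero unfolding c_def D_commute[of v x] by linarith
      have "sin (c / 2) * (cos a + cos b) \<le> sin c * cos r"
        using g(4)[OF c2 x(1) per] by (simp add: abr m_def c_def D_commute[of v] algebra_simps)
      also have "sin c = 2 * sin (c / 2) * cos (c / 2)" using sin_double[of "c / 2"] by simp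
      finally have "sin (c / 2) * (cos a + cos b) \<le> sin (c / 2) * (2 * cos (c / 2) * cos r)"
        by (simp add: algebra_simps)
      then show ?thesis using s by simp
    qed
    have ab: "0 \<le> a" "a \<le> \<Delta>" "0 \<le> b" "b \<le> \<Delta>" "0 \<le> r" using x by (auto simp: abr)
    have cab: "cos \<Delta> \<le> cos a" "cos \<Delta> \<le> cos b" using ab x by (auto intro!: cos_monotone_0_pi_le)
    have c\<Delta>: "0 < cos \<Delta>" using ab x by (intro cos_gt_zero_pi) auto
    have cc: "0 < cos (c / 2)" "cos (c / 2) \<le> 1" using c by (auto intro!: cos_gt_zero_pi)
    have "0 < 2 * cos (c / 2) * cos r" using main cab c\<Delta> by linarith
    then have cr: "0 < cos r" using cc by (simp add: zero_less_mult_iff)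
    have "cos (c / 2) * cos r \<le> 1 * cos r" using cc cr by (intro mult_right_mono) auto
    then have "cos \<Delta> \<le> cos r" using main cab by linarith
    have "r \<le> a + c / 2" using D_triangle[of x m u] um by (simp add: abr)
    then have "r < pi" using ab x c by linarith
    then have r: "r \<le> \<Delta>" using \<open>cos \<Delta> \<le> cos r\<close> ab x cos_monotone_0_pi[of \<Delta> r] by force
    have "2 * cos \<Delta> * (1 - cos (c / 2)) \<le> 2 * cos r * (1 - cos (c / 2))"
      using \<open>cos \<Delta> \<le> cos r\<close> cc by (intro mult_right_mono) auto
    also have "\<dots> \<le> 2 * cos r - cos a - cos b" using main by (simp add: algebra_simps)
    also have "\<dots> \<le> wt r * (2 * cos r - cos a - cos b)"
    proof -
      have "0 \<le> 2 * cos \<Delta> * (1 - cos (c / 2))" using c\<Delta> cc by (intro mult_nonneg_nonneg) auto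
      then have "0 \<le> 2 * cos r - cos a - cos b" using calculation by linarith
      then show ?thesis
        using mult_right_mono[of 1 "wt r" "2 * cos r - cos a - cos b"] wt_ge_1[of r] ab \<open>r < pi\<close> by simp
    qed
    finally have "4 * (cos \<Delta> * (1 - cos (c / 2))) \<le> 2 * wt r * (cos r - cos a) + 2 * wt r * (cos r - cos b)"
      by (simp add: algebra_simps)
    also have "\<dots> \<le> (a\<^sup>2 - r\<^sup>2) + (b\<^sup>2 - r\<^sup>2)"
      using ab x \<open>r < pi\<close> by (intro add_mono square_tangent_cos) auto
    finally have "r\<^sup>2 \<le> (a\<^sup>2 + b\<^sup>2) / 2 - 2 * cos \<Delta> * (1 - cos (c / 2))" by (simp add: field_simps)
    with r show ?thesis by (simp add: abr c_def)
  qed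
  then show ?thesis using g(1,3)[OF c2] unfolding m_def by (intro bexI[of _ "g (c / 2)"]) auto
qed

end

section \<open>Projections and minimisers for a convex set in a small ball\<close>

locale cat_spherical_ball = cat_spherical +
  fixes C :: "'a::metric_space set" and p :: 'a and R :: real
  assumes closed_C: "closed C" and C_subset: "C \<subseteq> M" and C_convex: "geodesically_convex M C"
    and p: "p \<in> M" and R: "0 \<le> R" "R < pi / 4" and C_ball: "x \<in> C \<Longrightarrow> D p x \<le> R"
begin

lemma C_diameter: "x \<in> C \<Longrightarrow> y \<in> C \<Longrightarrow> D x y \<le> 2 * R"
  using D_triangle[of x y p] C_ball[of x] C_ball[of y] by (simp add: D_commute[of x p])

lemma C_diameter_less: "x \<in> C \<Longrightarrow> y \<in> C \<Longrightarrow> D x y < pi / 2"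
  using C_diameter[of x y] R by linarith

lemma complete_C: "complete C"
  using complete_closed_subset[of C M] closed_C C_subset complete_M by blast

lemma M_convex: "geodesically_convex M M"
  by (auto simp: geodesically_convex_def geodesic_between_def)

text \<open>The lower bound depends on \<open>e\<close> alone, as
  \<open>complete_minimizer_exists\<close> demands of its \<open>\<delta>\<close>.\<close>

lemma convex_gap:
  assumes "0 < e" "e \<le> dist u v" "D u v < pi / 2"
  shows "0 < 1 - cos (min (k * e) 1 / 2)" "1 - cos (min (k * e) 1 / 2) \<le> 1 - cos (D u v / 2)"
proof -
  have e: "0 < min (k * e) 1" "min (k * e) 1 \<le> D u v"
    using assms k_pos by (auto simp: D_def min_le_iff_disj)
  have "cos (min (k * e) 1 / 2) < cos 0"
    using e(1) pi_ge_two by (intro cos_monotone_0_pi) auto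
  then show "0 < 1 - cos (min (k * e) 1 / 2)" by simp
  show "1 - cos (min (k * e) 1 / 2) \<le> 1 - cos (D u v / 2)"
    using e assms(3) by (auto intro!: cos_monotone_0_pi_le)
qed

text \<open>Uniform convexity requires distances from \<open>b\<close> below pi / 2, which may fail
  on parts of \<open>C\<close>. The minimisation is therefore carried out on the points of
  \<open>C\<close> no farther from \<open>b\<close> than \<open>x0\<close>.\<close>

lemma projection_exists:
  assumes "b \<in> M" "x0 \<in> C" "D b x0 < pi / 2"
  shows "\<exists>q\<in>C. \<forall>c\<in>C. D b q \<le> D b c"
proof -
  define \<Delta> where "\<Delta> = D b x0"
  define S where "S = {q \<in> C. D b q \<le> \<Delta>}"
  have "0 < cos \<Delta>" using assms(3) by (intro cos_gt_zero_pi) (auto simp: \<Delta>_def intro: less_le_trans[OF _ D_nonneg])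
  have "closed {q. D b q \<le> \<Delta>}" unfolding D_def by (intro closed_Collect_le continuous_intros)
  then have "closed S" using closed_C closed_Int[of C "{q. D b q \<le> \<Delta>}"] by (simp add: S_def Int_def)
  then have "complete S" using complete_closed_subset[of S M] complete_M C_subset by (auto simp: S_def)
  then have "\<exists>q\<in>S. \<forall>c\<in>S. (D b q)\<^sup>2 \<le> (D b c)\<^sup>2"
  proof (rule complete_minimizer_exists)
    show "S \<noteq> {}" using assms by (auto simp: S_def \<Delta>_def)
    show "continuous_on S (\<lambda>q. (D b q)\<^sup>2)" unfolding D_def by (intro continuous_intros)
    fix e :: real assume e: "0 < e"
    define \<eta> where "\<eta> = 1 - cos (min (k * e) 1 / 2)"
    show "\<exists>\<delta>>0. \<forall>u\<in>S. \<forall>v\<in>S. e \<le> dist u v \<longrightarrow> (\<exists>m\<in>S. (D b m)\<^sup>2 \<le> ((D b u)\<^sup>2 + (D b v)\<^sup>2) / 2 - \<delta>)"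
    proof (cases "\<exists>u\<in>S. \<exists>v\<in>S. e \<le> dist u v")
      case True
      then have "0 < \<eta>" using convex_gap(1)[OF e] C_diameter_less unfolding \<eta>_def S_def by blast
      show ?thesis
      proof (intro exI[of _ "2 * cos \<Delta> * \<eta>"] conjI ballI impI)
        show "0 < 2 * cos \<Delta> * \<eta>" using \<open>0 < cos \<Delta>\<close> \<open>0 < \<eta>\<close> by simp
        fix u v assume uv: "u \<in> S" "v \<in> S" "e \<le> dist u v"
        then have uv': "u \<in> C" "v \<in> C" "u \<in> M" "v \<in> M" "D b u \<le> \<Delta>" "D b v \<le> \<Delta>"
          using C_subset by (auto simp: S_def)
        obtain m where m: "m \<in> C" "D b m \<le> \<Delta>"
          "(D b m)\<^sup>2 \<le> ((D b u)\<^sup>2 + (D b v)\<^sup>2) / 2 - 2 * cos \<Delta> * (1 - cos (D u v / 2))"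
          using midpoint_uniform_convexity[OF uv'(3,4) C_diameter_less[OF uv'(1,2)]] C_convex uv' assms
          unfolding \<Delta>_def by blast
        have "\<eta> \<le> 1 - cos (D u v / 2)"
          using convex_gap(2)[OF e uv(3) C_diameter_less[OF uv'(1,2)]] by (simp add: \<eta>_def)
        then have "2 * cos \<Delta> * \<eta> \<le> 2 * cos \<Delta> * (1 - cos (D u v / 2))"
          using \<open>0 < cos \<Delta>\<close> by (intro mult_left_mono) auto
        then show "\<exists>m\<in>S. (D b m)\<^sup>2 \<le> ((D b u)\<^sup>2 + (D b v)\<^sup>2) / 2 - 2 * cos \<Delta> * \<eta>"
          using m by (intro bexI[of _ m]) (auto simp: S_def)
      qed
    next
      case False
      then show ?thesis by (intro exI[of _ 1]) auto
    qed
  qed simp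
  then obtain q where q: "q \<in> S" "\<And>c. c \<in> S \<Longrightarrow> (D b q)\<^sup>2 \<le> (D b c)\<^sup>2" by blast
  have "D b q \<le> D b c" if "c \<in> C" for c
  proof (cases "D b c \<le> \<Delta>")
    case True
    then have "(D b q)\<^sup>2 \<le> (D b c)\<^sup>2" using q(2) that by (auto simp: S_def)
    then show ?thesis by (rule power2_le_imp_le) simp
  next
    case False
    then show ?thesis using q(1) by (simp add: S_def)
  qed
  then show ?thesis using q(1) by (auto simp: S_def)
qed

text \<open>If \<open>b\<close> is at least pi / 2 away from all the data, any data point is better,
  since \<open>C\<close> has diameter below pi / 2. Otherwise the projection of \<open>b\<close>
  onto \<open>C\<close> is strictly closer to every point of \<open>C\<close>.\<close>

lemma closer_point_in_C:
  fixes n :: nat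
  assumes b: "b \<in> M" "b \<notin> C" and n: "0 < n" and x: "\<And>i. i < n \<Longrightarrow> x i \<in> C"
  shows "\<exists>q\<in>C. (\<Sum>i<n. (D (x i) q)\<^sup>2) < (\<Sum>i<n. (D (x i) b)\<^sup>2)"
proof (cases "\<exists>i<n. D b (x i) < pi / 2")
  case False
  have "(\<Sum>i<n. (D (x i) (x 0))\<^sup>2) < (\<Sum>i<n. (D (x i) b)\<^sup>2)"
  proof (rule sum_strict_mono)
    fix i assume "i \<in> {..<n}"
    then have "D (x i) (x 0) < D (x i) b"
      using False C_diameter_less[OF x x, of i 0] n by (fastforce simp: D_commute[of b])
    then show "(D (x i) (x 0))\<^sup>2 < (D (x i) b)\<^sup>2" by (intro power_strict_mono) auto
  qed (use n in auto)
  then show ?thesis using x[OF n] by blast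
next
  case True
  then obtain j where j: "j < n" "D b (x j) < pi / 2" by blast
  obtain q where q: "q \<in> C" "\<And>c. c \<in> C \<Longrightarrow> D b q \<le> D b c"
    using projection_exists[OF b(1) x[OF j(1)] j(2)] by blast
  have h: "D b q < pi / 2" using q(2)[OF x[OF j(1)]] j(2) by simp
  have "b \<noteq> q" using q(1) b(2) by blast
  then have h0: "0 < D b q" by simp
  have closer: "D y q < D y b" if y: "y \<in> C" for y
  proof (cases "D y b < pi / 2")
    case False
    then show ?thesis using C_diameter_less[OF y q(1)] by simp
  next
    case True
    have yq: "D q y < pi / 2" using C_diameter_less[OF q(1) y] .
    \<comment> \<open>The projection minimises over \<open>C\<close> the functional of the one-point
      measure at \<open>b\<close>. Its first variation is the Pythagorean inequality
      \<open>cos (D b y) \<le> cos (D q y) * cos (D b q)\<close>.\<close>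
    have "(\<Sum>i<1::nat. wt (D b q) * cos (D b y)) \<le> cos (D q y) * (\<Sum>i<1::nat. wt (D b q) * cos (D b q))"
      using C_convex C_subset q y yq h True b(1)
      by (intro first_variation[where x = "\<lambda>_::nat. b" and n = 1 and C = C])
         (auto simp: D_commute[of b y] intro!: power_mono)
    then have "wt (D b q) * cos (D b y) \<le> wt (D b q) * (cos (D q y) * cos (D b q))"
      by (simp add: mult_ac)
    moreover have "D b q < pi" using h pi_gt_zero by linarith
    then have "1 \<le> wt (D b q)" by (intro wt_ge_1) auto
    ultimately have "cos (D b y) \<le> cos (D q y) * cos (D b q)" by (simp add: mult_le_cancel_left)
    also have "\<dots> < cos (D q y) * 1"
    proof (rule mult_strict_left_mono)
      show "cos (D b q) < 1" using cos_monotone_0_pi[of 0 "D b q"] h h0 by simp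
      show "0 < cos (D q y)" using yq by (intro cos_gt_zero_pi) (auto intro: less_le_trans[OF _ D_nonneg])
    qed
    finally have "cos (D y b) < cos (D y q)" by (simp add: D_commute)
    moreover have "D y q \<le> pi" using yq pi_gt_zero unfolding D_commute[of q] by linarith
    ultimately show ?thesis using cos_monotone_0_pi_le[of "D y b" "D y q"] by force
  qed
  have "(\<Sum>i<n. (D (x i) q)\<^sup>2) < (\<Sum>i<n. (D (x i) b)\<^sup>2)"
    using closer x n by (intro sum_strict_mono power_strict_mono) auto
  then show ?thesis using q(1) by blast
qed

text \<open>Uniform convexity is at hand only on \<open>C\<close>, where all distances are at most
  \<open>2 * R\<close>, so the sum is minimised there; \<open>closer_point_in_C\<close> excludes
  better points outside.\<close>

lemma minimizer_exists:
  fixes n :: nat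
  assumes n: "0 < n" and x: "\<And>i. i < n \<Longrightarrow> x i \<in> C"
  shows "\<exists>b\<in>M. \<forall>c\<in>M. (\<Sum>i<n. (D (x i) b)\<^sup>2) \<le> (\<Sum>i<n. (D (x i) c)\<^sup>2)"
proof -
  have cR: "0 < cos (2 * R)" using R by (intro cos_gt_zero_pi) auto
  have "\<exists>b\<in>C. \<forall>c\<in>C. (\<Sum>i<n. (D (x i) b)\<^sup>2) \<le> (\<Sum>i<n. (D (x i) c)\<^sup>2)"
  proof (rule complete_minimizer_exists[OF complete_C])
    show "C \<noteq> {}" using x[OF n] by auto
    show "continuous_on C (\<lambda>b. \<Sum>i<n. (D (x i) b)\<^sup>2)" unfolding D_def by (intro continuous_intros)
    show "0 \<le> (\<Sum>i<n. (D (x i) b)\<^sup>2)" for b by (intro sum_nonneg) auto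
    fix e :: real assume e: "0 < e"
    define \<eta> where "\<eta> = 1 - cos (min (k * e) 1 / 2)"
    show "\<exists>\<delta>>0. \<forall>u\<in>C. \<forall>v\<in>C. e \<le> dist u v \<longrightarrow> (\<exists>m\<in>C. (\<Sum>i<n. (D (x i) m)\<^sup>2)
        \<le> ((\<Sum>i<n. (D (x i) u)\<^sup>2) + (\<Sum>i<n. (D (x i) v)\<^sup>2)) / 2 - \<delta>)"
    proof (cases "\<exists>u\<in>C. \<exists>v\<in>C. e \<le> dist u v")
      case True
      then have "0 < \<eta>" using convex_gap(1)[OF e] C_diameter_less unfolding \<eta>_def by blast
      show ?thesis
      proof (intro exI[of _ "real n * (2 * cos (2 * R) * \<eta>)"] conjI ballI impI)
        show "0 < real n * (2 * cos (2 * R) * \<eta>)" using cR n \<open>0 < \<eta>\<close> by simp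
        fix u v assume uv: "u \<in> C" "v \<in> C" "e \<le> dist u v"
        then have uvM: "u \<in> M" "v \<in> M" using C_subset by auto
        obtain m where conv: "\<forall>C. geodesically_convex M C \<longrightarrow> u \<in> C \<longrightarrow> v \<in> C \<longrightarrow> m \<in> C"
          and le: "\<forall>x\<in>M. \<forall>\<Delta>. D x u \<le> \<Delta> \<longrightarrow> D x v \<le> \<Delta> \<longrightarrow> \<Delta> < pi / 2 \<longrightarrow> D x m \<le> \<Delta> \<and>
            (D x m)\<^sup>2 \<le> ((D x u)\<^sup>2 + (D x v)\<^sup>2) / 2 - 2 * cos \<Delta> * (1 - cos (D u v / 2))"
          using midpoint_uniform_convexity[OF uvM C_diameter_less[OF uv(1,2)]] by blast
        have R2: "2 * R < pi / 2" using R by linarith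
        have m1: "m \<in> C" using conv C_convex uv(1,2) by blast
        have m2: "(D x m)\<^sup>2 \<le> ((D x u)\<^sup>2 + (D x v)\<^sup>2) / 2 - 2 * cos (2 * R) * (1 - cos (D u v / 2))"
          if "x \<in> M" "D x u \<le> 2 * R" "D x v \<le> 2 * R" for x
          using le[rule_format, OF that R2] by blast
        have "\<eta> \<le> 1 - cos (D u v / 2)"
          using convex_gap(2)[OF e uv(3) C_diameter_less[OF uv(1,2)]] by (simp add: \<eta>_def)
        then have \<eta>: "2 * cos (2 * R) * \<eta> \<le> 2 * cos (2 * R) * (1 - cos (D u v / 2))"
          using cR by (intro mult_left_mono) auto
        have "(\<Sum>i<n. (D (x i) m)\<^sup>2) \<le> (\<Sum>i<n. ((D (x i) u)\<^sup>2 + (D (x i) v)\<^sup>2) / 2 - 2 * cos (2 * R) * \<eta>)"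
        proof (rule sum_mono)
          fix i assume "i \<in> {..<n}"
          then have i: "x i \<in> C" "x i \<in> M" using x C_subset by auto
          show "(D (x i) m)\<^sup>2 \<le> ((D (x i) u)\<^sup>2 + (D (x i) v)\<^sup>2) / 2 - 2 * cos (2 * R) * \<eta>"
            using m2[OF i(2) C_diameter[OF i(1) uv(1)] C_diameter[OF i(1) uv(2)]] \<eta> by linarith
        qed
        also have "\<dots> = ((\<Sum>i<n. (D (x i) u)\<^sup>2) + (\<Sum>i<n. (D (x i) v)\<^sup>2)) / 2 - real n * (2 * cos (2 * R) * \<eta>)"
          by (simp add: sum_subtractf sum.distrib flip: sum_divide_distrib)
        finally show "\<exists>m\<in>C. (\<Sum>i<n. (D (x i) m)\<^sup>2)
          \<le> ((\<Sum>i<n. (D (x i) u)\<^sup>2) + (\<Sum>i<n. (D (x i) v)\<^sup>2)) / 2 - real n * (2 * cos (2 * R) * \<eta>)"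
          using m1 by blast
      qed
    next
      case False
      then show ?thesis by (intro exI[of _ 1]) auto
    qed
  qed
  then obtain b where b: "b \<in> C" "\<And>c. c \<in> C \<Longrightarrow> (\<Sum>i<n. (D (x i) b)\<^sup>2) \<le> (\<Sum>i<n. (D (x i) c)\<^sup>2)"
    by blast
  have "(\<Sum>i<n. (D (x i) b)\<^sup>2) \<le> (\<Sum>i<n. (D (x i) c)\<^sup>2)" if c: "c \<in> M" for c
  proof (cases "c \<in> C")
    case False
    then obtain q where "q \<in> C" "(\<Sum>i<n. (D (x i) q)\<^sup>2) < (\<Sum>i<n. (D (x i) c)\<^sup>2)"
      using closer_point_in_C[of c n x, OF c False n x] by blast
    then show ?thesis using b(2)[of q] by linarith
  qed (rule b)
  then show ?thesis using b(1) C_subset by blast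
qed

lemma minimizer_in_C:
  fixes n :: nat
  assumes "b \<in> M" "0 < n" "\<And>i. i < n \<Longrightarrow> x i \<in> C"
    and "\<And>c. c \<in> M \<Longrightarrow> (\<Sum>i<n. (D (x i) b)\<^sup>2) \<le> (\<Sum>i<n. (D (x i) c)\<^sup>2)"
  shows "b \<in> C"
  using closer_point_in_C[OF assms(1) _ assms(2,3)] assms(4) C_subset by (meson not_le subsetD)

section \<open>The Lipschitz estimate in positive curvature\<close>

text \<open>The test point \<open>p\<close> may lie outside \<open>C\<close>, so the variation takes
  place in \<open>M\<close> and \<open>b\<close> has to be minimal over \<open>M\<close>. On the
  left every weight is at least 1 and every cosine at least \<open>cos R\<close>.\<close>

lemma minimizer_weight:
  assumes b: "b \<in> C" and x: "\<And>i. i < n \<Longrightarrow> x i \<in> C"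
    and min: "\<And>c. c \<in> M \<Longrightarrow> (\<Sum>i<n. (D (x i) b)\<^sup>2) \<le> (\<Sum>i<n. (D (x i) c)\<^sup>2)"
  shows "real n * cos R \<le> cos (D p b) * (\<Sum>i<n. wt (D (x i) b) * cos (D (x i) b))"
proof -
  have px: "D (x i) p \<le> R" if "i < n" for i using C_ball[OF x[OF that]] by (simp add: D_commute)
  have bp: "D b p \<le> R" using C_ball[OF b] by (simp add: D_commute)
  have cR: "0 < cos R" using R by (intro cos_gt_zero_pi) auto
  have "real n * cos R = (\<Sum>i<n. cos R)" by simp
  also have "\<dots> \<le> (\<Sum>i<n. wt (D (x i) b) * cos (D (x i) p))"
  proof (rule sum_mono)
    fix i assume "i \<in> {..<n}"
    then have i: "i < n" by simp
    have "D (x i) b < pi" using C_diameter_less[OF x[OF i] b] pi_gt_zero by linarith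
    then have "1 \<le> wt (D (x i) b)" by (intro wt_ge_1) auto
    moreover have "cos R \<le> cos (D (x i) p)" using px[OF i] R by (intro cos_monotone_0_pi_le) auto
    ultimately show "cos R \<le> wt (D (x i) b) * cos (D (x i) p)"
      using cR mult_mono[of 1 "wt (D (x i) b)" "cos R" "cos (D (x i) p)"] by simp
  qed
  also have "\<dots> \<le> cos (D b p) * (\<Sum>i<n. wt (D (x i) b) * cos (D (x i) b))"
  proof (rule first_variation[OF M_convex subset_refl])
    show "b \<in> M" "p \<in> M" "\<And>i. i < n \<Longrightarrow> x i \<in> M" using b p x C_subset by auto
    show "D b p < pi / 2" using bp R by linarith
    show "D (x i) b < pi / 2" if "i < n" for i using C_diameter_less[OF x[OF that] b] .
    show "D (x i) p < pi / 2" if "i < n" for i using px[OF that] R by linarith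
  qed (rule min)
  finally show ?thesis by (simp add: D_commute)
qed

text \<open>The weights at \<open>b\<close> and \<open>b'\<close> differ. Replacing \<open>wt (D y b')\<close> by \<open>wt (D y b)\<close> only increases the
  left-hand side because \<open>wt\<close> increases while \<open>cos\<close> decreases; the remaining change of weight, from
  \<open>D y b\<close> to \<open>D x b\<close>, is controlled by \<open>D x y\<close>, so that the bound is linear in \<open>D x y\<close>.\<close>

lemma minimizer_term_bound:
  assumes C: "x \<in> C" "y \<in> C" "b \<in> C" "b' \<in> C" and q: "q = R + D p b"
  shows "wt (D x b) * (cos (D x b) - cos (D x b')) + wt (D y b') * (cos (D y b') - cos (D y b))
    \<le> 2 * sin (D b b' / 2) * ((wt q + wt_deriv q) * D x y)"
proof -
  define r t r' s c d where "r = D x b" "t = D x b'" "r' = D y b'" "s = D y b" "c = D b b'" "d = D x y"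
  note defs = this
  have nonneg: "0 \<le> r" "0 \<le> s" "0 \<le> r'" "0 \<le> c" "0 \<le> d" by (auto simp: defs)
  have M: "x \<in> M" "y \<in> M" "b \<in> M" "b' \<in> M" using C C_subset by auto
  have less: "r < pi / 2" "s < pi / 2" "r' < pi / 2" "c < pi / 2"
    using C C_diameter_less by (auto simp: defs)
  have q2: "q \<le> pi / 2" using C_ball[OF C(3)] R q by linarith
  \<comment> \<open>The two distances between which the weight is changed both end at
    \<open>b\<close>, so \<open>R + D p b\<close> bounds them. The distances to \<open>b'\<close>
    enter only through monotonicity.\<close>
  have rq: "r \<le> q" "s \<le> q"
    using D_triangle[of x b p] D_triangle[of y b p] C_ball[OF C(1)] C_ball[OF C(2)]
    by (auto simp: defs q D_commute[of _ p])
  have sc: "0 \<le> sin (c / 2)" using less nonneg by (intro sin_ge_zero) auto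
  have wrq: "wt r \<le> wt q" using nonneg rq q2 pi_gt_zero by (intro wt_mono) linarith+
  have wr: "0 \<le> wt r" using wt_ge_1[of r] nonneg less by simp
  have "cos r' + cos r - cos t - cos s \<le> 4 * sin (d / 2) * sin (c / 2)"
    using spherical_quadrilateral[OF M(1,2,4,3)] C C_diameter_less by (simp add: defs D_commute[of b' b])
  also have "\<dots> \<le> 2 * d * sin (c / 2)"
    using sin_x_le_x[of "d / 2"] nonneg sc by (intro mult_right_mono) auto
  finally have 1: "wt r * (cos r - cos t + (cos r' - cos s)) \<le> wt q * (2 * d * sin (c / 2))"
    using wr sc nonneg wrq by (intro order_trans[OF mult_left_mono mult_right_mono]) auto
  have 2: "(wt r' - wt s) * (cos r' - cos s) \<le> 0"
  proof (cases "r' \<le> s")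
    case True
    then have "wt r' \<le> wt s" "cos s \<le> cos r'"
      using nonneg less by (auto intro!: wt_mono cos_monotone_0_pi_le)
    then show ?thesis by (intro mult_nonpos_nonneg) auto
  next
    case False
    then have "wt s \<le> wt r'" "cos r' \<le> cos s"
      using nonneg less by (auto intro!: wt_mono cos_monotone_0_pi_le)
    then show ?thesis by (intro mult_nonneg_nonpos) auto
  qed
  have "\<bar>cos r' - cos s\<bar> \<le> 2 * sin (c / 2)"
  proof -
    have "\<bar>s - r'\<bar> \<le> c"
      using D_triangle[of y b b'] D_triangle[of y b' b] by (simp add: defs abs_le_iff D_commute[of b'])
    then have "sin \<bar>(s - r') / 2\<bar> \<le> sin (c / 2)"
      using less nonneg by (intro sin_monotone_2pi_le) auto
    moreover have "\<bar>sin z\<bar> = sin \<bar>z\<bar>" if "\<bar>z\<bar> \<le> pi" for z :: real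
      using that sin_ge_zero[of z] sin_ge_zero[of "- z"] by (cases "0 \<le> z") auto
    moreover have "\<bar>(s - r') / 2\<bar> \<le> pi"
      using \<open>\<bar>s - r'\<bar> \<le> c\<close> less(4) pi_gt_zero by simp
    moreover have "\<bar>cos r' - cos s\<bar> = 2 * \<bar>sin ((r' + s) / 2)\<bar> * \<bar>sin ((s - r') / 2)\<bar>"
      by (simp add: cos_diff_cos abs_mult)
    moreover have "\<bar>sin ((r' + s) / 2)\<bar> * \<bar>sin ((s - r') / 2)\<bar> \<le> 1 * \<bar>sin ((s - r') / 2)\<bar>"
      by (intro mult_right_mono) auto
    ultimately show ?thesis by simp
  qed
  moreover have "\<bar>wt s - wt r\<bar> \<le> wt_deriv q * d"
  proof -
    have "\<bar>s - r\<bar> \<le> d"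
      using D_triangle[of y b x] D_triangle[of x b y] by (simp add: defs abs_le_iff D_commute[of y x])
    then have "wt_deriv q * \<bar>s - r\<bar> \<le> wt_deriv q * d"
      using wt_deriv_nonneg[of q] rq nonneg q2 by (intro mult_left_mono) auto
    then show ?thesis using wt_lipschitz[of r q s] rq nonneg q2 by linarith
  qed
  ultimately have "\<bar>wt s - wt r\<bar> * \<bar>cos r' - cos s\<bar> \<le> wt_deriv q * d * (2 * sin (c / 2))"
    by (intro mult_mono) auto
  then have 3: "(wt s - wt r) * (cos r' - cos s) \<le> wt_deriv q * d * (2 * sin (c / 2))"
    by (metis abs_le_D1 abs_mult)
  have "wt r * (cos r - cos t) + wt r' * (cos r' - cos s)
      = wt r * (cos r - cos t + (cos r' - cos s)) + (wt r' - wt s) * (cos r' - cos s)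
        + (wt s - wt r) * (cos r' - cos s)"
    by (simp add: algebra_simps)
  also have "\<dots> \<le> wt q * (2 * d * sin (c / 2)) + wt_deriv q * d * (2 * sin (c / 2))"
    using 1 2 3 by linarith
  also have "\<dots> = 2 * sin (c / 2) * ((wt q + wt_deriv q) * d)" by (simp add: algebra_simps)
  finally show ?thesis by (simp add: defs)
qed

text \<open>The assumption \<open>le\<close> puts the name \<open>b\<close> on the minimiser nearer
  to \<open>p\<close>. Then \<open>cos (D p b') \<le> cos (D p b)\<close>, so the lower bound with
  \<open>cos (D p b)\<close> holds for both weighted sums; symmetry removes the assumption
  afterwards.\<close>

lemma minimizer_distance_aux:
  assumes b: "b \<in> C" and b': "b' \<in> C"
    and x: "\<And>i. i < n \<Longrightarrow> x i \<in> C" and y: "\<And>i. i < n \<Longrightarrow> y i \<in> C"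
    and minx: "\<And>c. c \<in> M \<Longrightarrow> (\<Sum>i<n. (D (x i) b)\<^sup>2) \<le> (\<Sum>i<n. (D (x i) c)\<^sup>2)"
    and miny: "\<And>c. c \<in> M \<Longrightarrow> (\<Sum>i<n. (D (y i) b')\<^sup>2) \<le> (\<Sum>i<n. (D (y i) c)\<^sup>2)"
    and le: "D p b \<le> D p b'"
  shows "real n * D b b' \<le> wt R * (4 / 3 + 2 * R * tan R) * (\<Sum>i<n. D (x i) (y i))"
proof (cases "b = b'")
  case True
  have "1 \<le> wt R" "0 \<le> tan R"
    using R wt_ge_1[of R] by (auto simp: tan_def intro!: divide_nonneg_nonneg sin_ge_zero cos_ge_zero)
  then show ?thesis using R True by (auto intro!: mult_nonneg_nonneg sum_nonneg)
next
  case False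
  define c \<rho> q S where "c = D b b'" "\<rho> = D p b" "q = R + \<rho>" "S = (\<Sum>i<n. D (x i) (y i))"
  note defs = this
  have c: "0 < c" "c \<le> 2 * R" using False C_diameter[OF b b'] by (simp_all add: defs)
  have \<rho>: "0 \<le> \<rho>" "\<rho> \<le> R" using C_ball[OF b] by (auto simp: defs)
  have q: "0 < q" "q \<le> pi / 2" using c \<rho> R by (auto simp: defs(3))
  have cR: "0 < cos R" using R by (intro cos_gt_zero_pi) auto
  have "\<rho> < pi / 2" "- (pi / 2) < \<rho>" using \<rho> R pi_gt_zero by linarith+
  then have c\<rho>: "0 < cos \<rho>" "cos (D p b') \<le> cos \<rho>"
    using \<rho> R le order_trans[OF C_ball[OF b'], of pi]
    by (auto simp: defs intro!: cos_gt_zero_pi cos_monotone_0_pi_le)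
  define A where "A = (\<Sum>i<n. wt (D (x i) b) * cos (D (x i) b))"
  define A' where "A' = (\<Sum>i<n. wt (D (y i) b') * cos (D (y i) b'))"
  have A: "real n * cos R \<le> cos \<rho> * A"
    using minimizer_weight[of b n x, OF b x minx] by (simp add: A_def defs)
  have "0 \<le> A'" unfolding A'_def
  proof (rule sum_nonneg)
    fix i assume "i \<in> {..<n}"
    then have "D (y i) b' < pi / 2" using C_diameter_less[OF y b'] by simp
    moreover from this have "D (y i) b' < pi" using pi_gt_zero by linarith
    ultimately show "0 \<le> wt (D (y i) b') * cos (D (y i) b')"
      using wt_ge_1[of "D (y i) b'"] by (intro mult_nonneg_nonneg cos_ge_zero) (auto intro: order_trans[OF _ D_nonneg])
  qed
  then have A': "real n * cos R \<le> cos \<rho> * A'"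
    using minimizer_weight[of b' n y, OF b' y miny] mult_right_mono[OF c\<rho>(2)] unfolding A'_def[symmetric] by force
  have V: "(\<Sum>i<n. wt (D (x i) b) * cos (D (x i) b')) \<le> cos c * A"
    unfolding A_def defs
    using b b' x C_subset C_diameter_less
    by (intro first_variation[OF M_convex subset_refl _ _ _ _ _ _ minx]) auto
  have V': "(\<Sum>i<n. wt (D (y i) b') * cos (D (y i) b)) \<le> cos c * A'"
    unfolding A'_def defs D_commute[of b b']
    using b b' y C_subset C_diameter_less
    by (intro first_variation[OF M_convex subset_refl _ _ _ _ _ _ miny]) auto
  define Sn where "Sn = 2 * sin (c / 2)"
  have Sn: "0 < Sn" using c R by (auto simp: Sn_def intro!: sin_gt_zero)
  define W where "W = wt q + wt_deriv q"
  \<comment> \<open>\<open>Sn\<close> is the chord of \<open>c\<close>. The left side of the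
    estimate is quadratic in it and the right side linear, so one factor cancels.\<close>
  have cos_c: "1 - cos c = Sn * sin (c / 2)"
    using cos_double_sin[of "c / 2"] by (simp add: Sn_def power2_eq_square)
  have "(1 - cos c) * (2 * (real n * cos R)) \<le> (1 - cos c) * (cos \<rho> * (A + A'))"
    using A A' by (intro mult_left_mono) (auto simp: algebra_simps)
  also have "\<dots> \<le> cos \<rho> * (\<Sum>i<n. wt (D (x i) b) * (cos (D (x i) b) - cos (D (x i) b'))
      + wt (D (y i) b') * (cos (D (y i) b') - cos (D (y i) b)))"
  proof -
    have "(1 - cos c) * (A + A') \<le> (\<Sum>i<n. wt (D (x i) b) * (cos (D (x i) b) - cos (D (x i) b'))
      + wt (D (y i) b') * (cos (D (y i) b') - cos (D (y i) b)))"
      using V V' by (simp add: A_def A'_def sum.distrib sum_subtractf algebra_simps)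
    then have "cos \<rho> * ((1 - cos c) * (A + A')) \<le> cos \<rho> * (\<Sum>i<n. wt (D (x i) b) * (cos (D (x i) b) - cos (D (x i) b'))
      + wt (D (y i) b') * (cos (D (y i) b') - cos (D (y i) b)))"
      using c\<rho>(1) by (intro mult_left_mono) auto
    then show ?thesis by (simp only: mult_ac)
  qed
  also have "\<dots> \<le> cos \<rho> * (\<Sum>i<n. Sn * (W * D (x i) (y i)))"
    unfolding Sn_def W_def defs(1)
    using c\<rho>(1) x y b b' by (intro mult_left_mono sum_mono minimizer_term_bound) (auto simp: defs)
  also have "\<dots> = Sn * (cos \<rho> * W * S)" by (simp add: defs sum_distrib_left mult_ac)
  finally have "Sn * (Sn * (real n * cos R)) \<le> Sn * (cos \<rho> * W * S)"
    unfolding cos_c by (simp add: Sn_def algebra_simps)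
  then have 1: "Sn * (real n * cos R) \<le> cos \<rho> * W * S" using Sn by simp
  have S: "0 \<le> S" by (auto simp: defs intro!: sum_nonneg)
  \<comment> \<open>Writing \<open>\<rho>\<close> as \<open>q - R\<close> exposes the factor
    \<open>cos R\<close>, which cancels against the one from the weights and leaves
    \<open>tan R\<close> as the \<open>\<tau>\<close> of the weight bound.\<close>
  have "cos \<rho> = cos (q - R)" by (simp add: defs)
  also have "\<dots> = cos R * (cos q + tan R * sin q)"
    using cR by (simp add: cos_diff tan_def algebra_simps)
  finally have c\<rho>': "cos \<rho> = cos R * (cos q + tan R * sin q)" .
  have "cos R * (Sn * real n) \<le> cos R * ((cos q + tan R * sin q) * W * S)"
    using 1 unfolding c\<rho>' by (simp add: mult_ac)
  then have "Sn * real n \<le> (cos q + tan R * sin q) * W * S" using cR by simp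
  also have "\<dots> \<le> (4 / 3 + tan R * q) * S"
  proof (rule mult_right_mono[OF _ S])
    have "0 \<le> tan R" using R cR by (auto simp: tan_def intro!: divide_nonneg_pos sin_ge_zero)
    \<comment> \<open>This uses \<open>R < pi / 4\<close> and supplies the hypothesis
      \<open>\<tau> \<le> 1\<close>.\<close>
    moreover have "tan R \<le> 1" using R tan_monotone'[of R "pi / 4"] by (force simp: tan_45)
    ultimately show "(cos q + tan R * sin q) * W \<le> 4 / 3 + tan R * q"
      unfolding W_def using q by (intro wt_plus_wt_deriv_bound) auto
  qed
  also have "\<dots> \<le> (4 / 3 + 2 * R * tan R) * S"
  proof (rule mult_right_mono[OF _ S])
    have "0 \<le> tan R" using R cR by (auto simp: tan_def intro!: divide_nonneg_pos sin_ge_zero)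
    then have "tan R * q \<le> tan R * (2 * R)" using \<rho> by (intro mult_left_mono) (auto simp: defs)
    then show "4 / 3 + tan R * q \<le> 4 / 3 + 2 * R * tan R" by (simp add: mult_ac)
  qed
  finally have 2: "Sn * real n \<le> (4 / 3 + 2 * R * tan R) * S" .
  \<comment> \<open>Return from chord to arc: \<open>c\<close> is \<open>wt (c / 2)\<close> times
    the chord, and \<open>c / 2\<close> is at most \<open>R\<close>.\<close>
  have wR: "wt (c / 2) \<le> wt R" "1 \<le> wt (c / 2)" using c R by (auto intro!: wt_mono wt_ge_1)
  have "c = wt (c / 2) * Sn" using wt_mult_sin[of "c / 2"] c R by (simp add: Sn_def)
  then have "real n * c = wt (c / 2) * (Sn * real n)" by simp
  also have "\<dots> \<le> wt R * (Sn * real n)" using wR Sn by (intro mult_right_mono) auto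
  also have "\<dots> \<le> wt R * ((4 / 3 + 2 * R * tan R) * S)" using 2 wR by (intro mult_left_mono) auto
  finally show ?thesis by (simp add: defs mult.assoc)
qed

lemma minimizer_distance:
  assumes n: "0 < n" and b: "b \<in> M" and b': "b' \<in> M"
    and x: "\<And>i. i < n \<Longrightarrow> x i \<in> C" and y: "\<And>i. i < n \<Longrightarrow> y i \<in> C"
    and minx: "\<And>c. c \<in> M \<Longrightarrow> (\<Sum>i<n. (D (x i) b)\<^sup>2) \<le> (\<Sum>i<n. (D (x i) c)\<^sup>2)"
    and miny: "\<And>c. c \<in> M \<Longrightarrow> (\<Sum>i<n. (D (y i) b')\<^sup>2) \<le> (\<Sum>i<n. (D (y i) c)\<^sup>2)"
  shows "real n * D b b' \<le> wt R * (4 / 3 + 2 * R * tan R) * (\<Sum>i<n. D (x i) (y i))"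
proof -
  have "b \<in> C" "b' \<in> C"
    using minimizer_in_C[of b n x, OF b n x minx] minimizer_in_C[of b' n y, OF b' n y miny] by auto
  then show ?thesis
    using minimizer_distance_aux[of b b' n x y, OF _ _ x y minx miny]
      minimizer_distance_aux[of b' b n y x, OF _ _ y x miny minx]
    by (cases "D p b \<le> D p b'") (auto simp: D_commute[of b' b] D_commute[of "y _"])
qed

lemma barycenter_minimizer:
  assumes n: "0 < n" and x: "\<And>i. i < n \<Longrightarrow> x i \<in> C"
  shows "barycenter M n x \<in> M"
    "\<And>c. c \<in> M \<Longrightarrow> (\<Sum>i<n. (D (x i) (barycenter M n x))\<^sup>2) \<le> (\<Sum>i<n. (D (x i) c)\<^sup>2)"
proof -
  have D_dist: "(\<Sum>i<n. (D (x i) b)\<^sup>2) \<le> (\<Sum>i<n. (D (x i) c)\<^sup>2)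
      \<longleftrightarrow> (\<Sum>i<n. (dist (x i) b)\<^sup>2) \<le> (\<Sum>i<n. (dist (x i) c)\<^sup>2)" for b c
    using k_pos by (simp add: D_def power_mult_distrib flip: sum_distrib_left)
  obtain b where b: "b \<in> M" "\<And>c. c \<in> M \<Longrightarrow> (\<Sum>i<n. (D (x i) b)\<^sup>2) \<le> (\<Sum>i<n. (D (x i) c)\<^sup>2)"
    using minimizer_exists[of n x, OF n x] by blast
  have "barycenter M n x = b"
  proof (rule barycenter_eqI[OF b(1) b(2)[unfolded D_dist] _ n])
    fix b' assume b': "b' \<in> M" "\<And>c. c \<in> M \<Longrightarrow> (\<Sum>i<n. (dist (x i) b')\<^sup>2) \<le> (\<Sum>i<n. (dist (x i) c)\<^sup>2)"
    \<comment> \<open>With the same data on both sides the distance estimate forces two minimisers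
      to coincide.\<close>
    have "real n * D b b' \<le> wt R * (4 / 3 + 2 * R * tan R) * (\<Sum>i<n. D (x i) (x i))"
      using b b' by (intro minimizer_distance[OF n _ _ x x]) (auto simp: D_dist)
    then have "D b b' \<le> 0" using n by (simp add: mult_le_0_iff)
    then have "D b b' = 0" using D_nonneg[of b b'] by linarith
    then show "b' = b" by simp
  qed
  then show "barycenter M n x \<in> M"
    "\<And>c. c \<in> M \<Longrightarrow> (\<Sum>i<n. (D (x i) (barycenter M n x))\<^sup>2) \<le> (\<Sum>i<n. (D (x i) c)\<^sup>2)"
    using b by auto
qed

end

section \<open>Rescaling to curvature 1 and conclusion\<close>

lemma CAT_imp_cat_spherical:
  fixes M :: "'a::metric_space set"
  assumes CAT: "CAT \<kappa> M" and "0 < \<kappa>"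
  shows "cat_spherical M (sqrt \<kappa>) (\<lambda>x y. sqrt \<kappa> * dist x y)"
proof
  define k where "k = sqrt \<kappa>"
  have k: "0 < k" using assms(2) by (simp add: k_def)
  show "0 < sqrt \<kappa>" using assms(2) by simp
  show "complete M" using CAT by (simp add: CAT_def)
  fix y z assume yz: "y \<in> M" "z \<in> M"
  have "geodesic_space M" using CAT by (simp add: CAT_def)
  then obtain \<gamma> where \<gamma>: "geodesic_between M dist \<gamma> y z"
    using yz unfolding geodesic_space_def by blast
  show "\<exists>g. \<forall>s\<in>{0..sqrt \<kappa> * dist y z}. g s \<in> M \<and> sqrt \<kappa> * dist y (g s) = s \<and>
      (\<forall>C. geodesically_convex M C \<longrightarrow> y \<in> C \<longrightarrow> z \<in> C \<longrightarrow> g s \<in> C) \<and>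
      (\<forall>x\<in>M. sqrt \<kappa> * dist x y + sqrt \<kappa> * dist y z + sqrt \<kappa> * dist z x < 2 * pi \<longrightarrow>
        sin (sqrt \<kappa> * dist y z - s) * cos (sqrt \<kappa> * dist x y) + sin s * cos (sqrt \<kappa> * dist x z)
        \<le> sin (sqrt \<kappa> * dist y z) * cos (sqrt \<kappa> * dist x (g s)))"
    unfolding k_def[symmetric]
  proof (intro exI ballI conjI allI impI)
    fix s assume s: "s \<in> {0..k * dist y z}"
    then have sk: "s / k \<in> {0..dist y z}" using k by (auto simp: field_simps)
    have im: "\<gamma> ` {0..dist y z} \<subseteq> M" and 0: "\<gamma> 0 = y"
      and d: "\<And>s t. s \<in> {0..dist y z} \<Longrightarrow> t \<in> {0..dist y z} \<Longrightarrow> dist (\<gamma> s) (\<gamma> t) = \<bar>s - t\<bar>"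
      using \<gamma> by (auto simp: geodesic_between_def)
    show "\<gamma> (s / k) \<in> M" using im sk by blast
    have "dist (\<gamma> 0) (\<gamma> (s / k)) = \<bar>0 - s / k\<bar>" using sk by (intro d) auto
    then show "k * dist y (\<gamma> (s / k)) = s" using k s by (simp add: 0)
    show "\<gamma> (s / k) \<in> C" if "geodesically_convex M C" "y \<in> C" "z \<in> C" for C
      using that \<gamma> sk unfolding geodesically_convex_def by blast
    fix x assume x: "x \<in> M" "k * dist x y + k * dist y z + k * dist z x < 2 * pi"
    have "k * (dist y z - s / k) = k * dist y z - s" "k * (s / k) = s"
      using k by (simp_all add: right_diff_distrib)
    then show "sin (k * dist y z - s) * cos (k * dist x y) + sin s * cos (k * dist x z)
        \<le> sin (k * dist y z) * cos (k * dist x (\<gamma> (s / k)))"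
      using CAT_spherical_comparison[OF CAT assms(2) x(1) yz \<gamma> _ sk] x(2)
      unfolding k_def[symmetric] by (simp add: dist_commute distrib_left)
  qed
qed simp

theorem mainTheorem3:
  fixes \<kappa> :: real and \<epsilon> :: real and M C :: "'a::metric_space set" and n :: nat
    and x y :: "nat \<Rightarrow> 'a"
  assumes "CAT \<kappa> M"
    and "convex_domain \<kappa> M C"
    and "\<kappa> > 0 \<Longrightarrow> \<epsilon> > 0 \<and> (\<exists>p\<in>M. C \<subseteq> cball p ((Dk \<kappa> / 2 - \<epsilon>) / 2))"
    and "n \<ge> 1"
    and "\<forall>i<n. x i \<in> C" and "\<forall>i<n. y i \<in> C"
  shows "dist (barycenter M n x) (barycenter M n y)
           \<le> ((if \<kappa> \<le> 0 then 1 else 2 / (\<epsilon> powr (1/4) * \<kappa> powr (1/8))) / real n)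
              * (\<Sum>i<n. dist (x i) (y i))"
proof -
  have n: "0 < n" using assms(4) by simp
  have C: "C \<subseteq> M" "closed C" "geodesically_convex M C" using assms(2) by (auto simp: convex_domain_def)
  have x: "\<And>i. i < n \<Longrightarrow> x i \<in> C" and y: "\<And>i. i < n \<Longrightarrow> y i \<in> C" using assms(5,6) by auto
  show ?thesis
  proof (cases "\<kappa> \<le> 0")
    case True
    have "real n * dist (barycenter M n x) (barycenter M n y) \<le> (\<Sum>i<n. dist (x i) (y i))"
      using CAT_imp_nonpos_curved[OF assms(1) True] assms(1) n x y C(1)
      by (intro barycenter_lipschitz_nonpos_curved) (auto simp: CAT_def)
    then show ?thesis using n True by (simp add: field_simps)
  next
    case False
    then have \<kappa>: "0 < \<kappa>" by simp
    define k where "k = sqrt \<kappa>"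
    have k: "0 < k" using \<kappa> by (simp add: k_def)
    obtain p where \<epsilon>: "0 < \<epsilon>" and p: "p \<in> M" "C \<subseteq> cball p ((Dk \<kappa> / 2 - \<epsilon>) / 2)"
      using assms(3)[OF \<kappa>] by blast
    define R where "R = k * ((Dk \<kappa> / 2 - \<epsilon>) / 2)"
    have R: "R = pi / 4 - k * \<epsilon> / 2" using k by (simp add: R_def Dk_def k_def[symmetric] field_simps)
    have eps: "k * \<epsilon> = pi / 2 - 2 * R" by (simp add: R field_simps)
    have ball: "k * dist p z \<le> R" if "z \<in> C" for z
      using p(2) that k unfolding R_def by (intro mult_left_mono) auto
    \<comment> \<open>The given radius has no sign a priori; since \<open>n\<close> is positive,
      \<open>x 0\<close> lies in the ball and the radius is nonnegative.\<close>
    have R0: "0 \<le> R" using ball[OF x[OF n]] k by (smt (verit) mult_nonneg_nonneg zero_le_dist)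
    have R1: "R < pi / 4" using R k \<epsilon> by simp
    interpret cat_spherical M k "\<lambda>x y. k * dist x y"
      unfolding k_def by (rule CAT_imp_cat_spherical[OF assms(1) \<kappa>])
    interpret cat_spherical_ball M k "\<lambda>x y. k * dist x y" C p R
      by unfold_locales (use C p R0 R1 ball in auto)
    define L where "L = wt R * (4 / 3 + 2 * R * tan R)"
    have "real n * (k * dist (barycenter M n x) (barycenter M n y)) \<le> L * (\<Sum>i<n. k * dist (x i) (y i))"
      unfolding L_def using barycenter_minimizer[of n x] barycenter_minimizer[of n y] n x y
      by (intro minimizer_distance) auto
    then have "k * (real n * dist (barycenter M n x) (barycenter M n y)) \<le> k * (L * (\<Sum>i<n. dist (x i) (y i)))"
      by (simp add: mult_ac flip: sum_distrib_left)
    then have "real n * dist (barycenter M n x) (barycenter M n y) \<le> L * (\<Sum>i<n. dist (x i) (y i))"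
      using k by simp
    also have "\<dots> \<le> (2 / (k * \<epsilon>) powr (1 / 4)) * (\<Sum>i<n. dist (x i) (y i))"
      unfolding L_def using R0 R1 eps
      by (intro mult_right_mono lipschitz_constant_bound sum_nonneg) auto
    \<comment> \<open>The exponent 1 / 8 is due to the rescaling: \<epsilon> is multiplied by
      \<open>sqrt \<kappa>\<close> before the fourth root is taken.\<close>
    also have "(k * \<epsilon>) powr (1 / 4) = \<epsilon> powr (1 / 4) * \<kappa> powr (1 / 8)"
      using k \<epsilon> \<kappa> by (simp add: powr_mult k_def powr_powr flip: powr_half_sqrt)
    finally have le: "real n * dist (barycenter M n x) (barycenter M n y)
        \<le> 2 / (\<epsilon> powr (1 / 4) * \<kappa> powr (1 / 8)) * (\<Sum>i<n. dist (x i) (y i))" .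
    have "dist (barycenter M n x) (barycenter M n y)
        \<le> 2 / (\<epsilon> powr (1 / 4) * \<kappa> powr (1 / 8)) * (\<Sum>i<n. dist (x i) (y i)) / real n"
      by (rule mult_imp_le_div_pos) (use n le in \<open>simp_all only: of_nat_0_less_iff mult.commute\<close>)
    then show ?thesis using False by simp
  qed
qed

end
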